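(* Let $(R,\mathfrak{m},k)$ be a commutative Noetherian local ring and let $\{x,y\}$ be a pair of exact zerodivisors of $R$. Assume that the local ring $R/(x)$ is G-regular. Then for any integer $n$ with $0\le n\le\operatorname{s}(x,y)$ there exists an exact sequence of $R$-modules $0 \to (R/(x))^n \to M \to R/(y) \to 0$ such that $M$ is indecomposable.
   Context: A pair of exact zerodivisors of $R$ is a pair of elements $x,y\in\mathfrak{m}$ with $(0:x)=(y)$ and $(0:y)=(x)$. A finitely generated module $M$ over a local ring $A$ is totally reflexive if $M\to M^{**}$ is an isomorphism and $\operatorname{Ext}^i_A(M,A)=0=\operatorname{Ext}^i_A(M^*,A)$ for all $i>0$, where $(-)^*=\operatorname{Hom}_A(-,A)$; $A$ is G-regular if every totally reflexive $A$-module is free. For $x,y\in\mathfrak{m}$, $\operatorname{s}(x,y)\in\{0,1,2,\dots\}\cup\{\infty\}$ is the supremum of the nonnegative integers $n$ such that there exists an ideal $I$ of $R$ whose image $I(R/(x,y))$ has minimal number of generators (as an $R/(x,y)$-module) equal to $n$. *)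

theory Defs
  imports "HOL-Algebra.Algebra" "HOL-Library.Extended_Nat"
begin

definition mod_hom :: "('a, 'c) ring_scheme \<Rightarrow> ('a, 'm) module \<Rightarrow> ('a, 'n) module \<Rightarrow> ('m \<Rightarrow> 'n) set"
  where "mod_hom A M N = {f. f \<in> carrier M \<rightarrow> carrier N
      \<and> (\<forall>u\<in>carrier M. \<forall>v\<in>carrier M. f (u \<oplus>\<^bsub>M\<^esub> v) = f u \<oplus>\<^bsub>N\<^esub> f v)
      \<and> (\<forall>a\<in>carrier A. \<forall>u\<in>carrier M. f (smult M a u) = smult N a (f u))}"

definition ring_mod :: "('a, 'c) ring_scheme \<Rightarrow> ('a, 'a) module"
  where "ring_mod A = \<lparr>partial_object.carrier = carrier A, monoid.mult = monoid.mult A, monoid.one = monoid.one A,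
                        ring.zero = ring.zero A, ring.add = ring.add A, module.smult = monoid.mult A\<rparr>"

definition ideal_mod :: "('a, 'c) ring_scheme \<Rightarrow> 'a set \<Rightarrow> ('a, 'a) module"
  where "ideal_mod A I = (ring_mod A)\<lparr>carrier := I\<rparr>"

definition power_mod :: "('a, 'm) module \<Rightarrow> nat \<Rightarrow> ('a, nat \<Rightarrow> 'm) module"
  where "power_mod M n = \<lparr>partial_object.carrier = {v. (\<forall>i<n. v i \<in> carrier M) \<and> (\<forall>i\<ge>n. v i = \<zero>\<^bsub>M\<^esub>)},
      monoid.mult = (\<lambda>_ _ _. \<zero>\<^bsub>M\<^esub>), monoid.one = (\<lambda>_. \<zero>\<^bsub>M\<^esub>),
      ring.zero = (\<lambda>_. \<zero>\<^bsub>M\<^esub>),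
      ring.add = (\<lambda>v w i. if i < n then v i \<oplus>\<^bsub>M\<^esub> w i else \<zero>\<^bsub>M\<^esub>),
      module.smult = (\<lambda>a v i. if i < n then smult M a (v i) else \<zero>\<^bsub>M\<^esub>)\<rparr>"

definition quot_mod :: "('a, 'c) ring_scheme \<Rightarrow> 'a set \<Rightarrow> ('a, 'a set) module"
  where "quot_mod R I = \<lparr>partial_object.carrier = carrier (R Quot I), monoid.mult = monoid.mult (R Quot I),
      monoid.one = monoid.one (R Quot I), ring.zero = ring.zero (R Quot I), ring.add = ring.add (R Quot I),
      module.smult = (\<lambda>r C. (I +>\<^bsub>R\<^esub> r) \<otimes>\<^bsub>R Quot I\<^esub> C)\<rparr>"

definition dual :: "('a, 'c) ring_scheme \<Rightarrow> ('a, 'm) module \<Rightarrow> ('a, 'm \<Rightarrow> 'a) module"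
  where "dual A M = \<lparr>partial_object.carrier = mod_hom A M (ring_mod A) \<inter> extensional (carrier M),
      monoid.mult = (\<lambda>_ _. \<lambda>u\<in>carrier M. \<zero>\<^bsub>A\<^esub>), monoid.one = (\<lambda>u\<in>carrier M. \<zero>\<^bsub>A\<^esub>),
      ring.zero = (\<lambda>u\<in>carrier M. \<zero>\<^bsub>A\<^esub>),
      ring.add = (\<lambda>f g. \<lambda>u\<in>carrier M. f u \<oplus>\<^bsub>A\<^esub> g u),
      module.smult = (\<lambda>a f. \<lambda>u\<in>carrier M. a \<otimes>\<^bsub>A\<^esub> f u)\<rparr>"

definition generates :: "('a, 'c) ring_scheme \<Rightarrow> ('a, 'm) module \<Rightarrow> 'm set \<Rightarrow> bool"
  where "generates A M S \<longleftrightarrow> S \<subseteq> carrier M \<and>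
      (\<forall>H. submodule H A M \<and> S \<subseteq> H \<longrightarrow> carrier M \<subseteq> H)"

definition fin_gen :: "('a, 'c) ring_scheme \<Rightarrow> ('a, 'm) module \<Rightarrow> bool"
  where "fin_gen A M \<longleftrightarrow> (\<exists>S. finite S \<and> generates A M S)"

definition mu_gens :: "('a, 'c) ring_scheme \<Rightarrow> ('a, 'm) module \<Rightarrow> nat"
  where "mu_gens A M = (LEAST n. \<exists>S. finite S \<and> card S = n \<and> generates A M S)"

definition free_fg :: "('a, 'c) ring_scheme \<Rightarrow> ('a, 'm) module \<Rightarrow> bool"
  where "free_fg A M \<longleftrightarrow> (\<exists>n f. f \<in> mod_hom A (power_mod (ring_mod A) n) M \<and>
      bij_betw f (carrier (power_mod (ring_mod A) n)) (carrier M))"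

text \<open>Ext^i_A(M, A) = 0 for all i > 0, computed from a resolution of M by finitely generated
  free modules F_i = A^(r i):  ... --d 1--> F_1 --d 0--> F_0 --eps--> M --> 0,
  as the vanishing of the cohomology of Hom_A(F, A) in degrees i >= 1.\<close>
definition Ext_pos_vanish :: "('a, 'c) ring_scheme \<Rightarrow> ('a, 'm) module \<Rightarrow> bool"
  where "Ext_pos_vanish A M \<longleftrightarrow>
    (\<exists>(r::nat \<Rightarrow> nat) (eps::(nat \<Rightarrow> 'a) \<Rightarrow> 'm) (d::nat \<Rightarrow> (nat \<Rightarrow> 'a) \<Rightarrow> (nat \<Rightarrow> 'a)).
      eps \<in> mod_hom A (power_mod (ring_mod A) (r 0)) M \<and>
      eps ` carrier (power_mod (ring_mod A) (r 0)) = carrier M \<and>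
      (\<forall>i. d i \<in> mod_hom A (power_mod (ring_mod A) (r (Suc i))) (power_mod (ring_mod A) (r i))) \<and>
      {v \<in> carrier (power_mod (ring_mod A) (r 0)). eps v = \<zero>\<^bsub>M\<^esub>}
        = d 0 ` carrier (power_mod (ring_mod A) (r 1)) \<and>
      (\<forall>i. {v \<in> carrier (power_mod (ring_mod A) (r (Suc i))).
              d i v = \<zero>\<^bsub>power_mod (ring_mod A) (r i)\<^esub>}
           = d (Suc i) ` carrier (power_mod (ring_mod A) (r (Suc (Suc i))))) \<and>
      (\<forall>i\<ge>1. \<forall>\<phi>\<in>carrier (dual A (power_mod (ring_mod A) (r i))).
          (\<forall>v\<in>carrier (power_mod (ring_mod A) (r (Suc i))). \<phi> (d i v) = \<zero>\<^bsub>A\<^esub>) \<longrightarrow>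
          (\<exists>\<psi>\<in>carrier (dual A (power_mod (ring_mod A) (r (i - 1)))).
              \<forall>v\<in>carrier (power_mod (ring_mod A) (r i)). \<phi> v = \<psi> (d (i - 1) v))))"

definition totally_reflexive :: "('a, 'c) ring_scheme \<Rightarrow> ('a, 'm) module \<Rightarrow> bool"
  where "totally_reflexive A M \<longleftrightarrow> module A M \<and> fin_gen A M \<and>
      bij_betw (\<lambda>u. \<lambda>f\<in>carrier (dual A M). f u) (carrier M) (carrier (dual A (dual A M))) \<and>
      Ext_pos_vanish A M \<and> Ext_pos_vanish A (dual A M)"

text \<open>G-regular: every totally reflexive A-module is free.  Modules are quantified over the
  carrier type (nat => 'a) set, which contains an isomorphic copy (A^n/N) of every finitely
  generated A-module.\<close>
definition G_regular :: "('a, 'c) ring_scheme \<Rightarrow> bool"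
  where "G_regular A \<longleftrightarrow>
      (\<forall>M :: ('a, (nat \<Rightarrow> 'a) set) module. totally_reflexive A M \<longrightarrow> free_fg A M)"

definition indecomposable :: "('a, 'c) ring_scheme \<Rightarrow> ('a, 'm) module \<Rightarrow> bool"
  where "indecomposable A M \<longleftrightarrow> carrier M \<noteq> {\<zero>\<^bsub>M\<^esub>} \<and>
      (\<forall>N1 N2. submodule N1 A M \<and> submodule N2 A M \<and> N1 \<inter> N2 = {\<zero>\<^bsub>M\<^esub>} \<and>
         {a \<oplus>\<^bsub>M\<^esub> b | a b. a \<in> N1 \<and> b \<in> N2} = carrier M
         \<longrightarrow> N1 = {\<zero>\<^bsub>M\<^esub>} \<or> N2 = {\<zero>\<^bsub>M\<^esub>})"

definition local_ring :: "('a, 'c) ring_scheme \<Rightarrow> bool"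
  where "local_ring R \<longleftrightarrow> cring R \<and> (\<exists>!m. maximalideal m R)"

definition annihilator :: "('a, 'c) ring_scheme \<Rightarrow> 'a \<Rightarrow> 'a set"
  where "annihilator R x = {r \<in> carrier R. r \<otimes>\<^bsub>R\<^esub> x = \<zero>\<^bsub>R\<^esub>}"

definition exact_zerodivisors :: "('a, 'c) ring_scheme \<Rightarrow> 'a set \<Rightarrow> 'a \<Rightarrow> 'a \<Rightarrow> bool"
  where "exact_zerodivisors R m x y \<longleftrightarrow> x \<in> m \<and> y \<in> m \<and>
      annihilator R x = Idl\<^bsub>R\<^esub> {y} \<and> annihilator R y = Idl\<^bsub>R\<^esub> {x}"

definition s_inv :: "('a, 'c) ring_scheme \<Rightarrow> 'a \<Rightarrow> 'a \<Rightarrow> enat"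
  where "s_inv R x y = (let J = Idl\<^bsub>R\<^esub> {x, y}; S = R Quot J in
      Sup {enat (mu_gens S (ideal_mod S (Idl\<^bsub>S\<^esub> ((\<lambda>a. J +>\<^bsub>R\<^esub> a) ` I)))) | I. ideal I R})"

end

(*
  The class of (z_1, ..., z_n) in (R/(x,y))^n = Ext^1(R/(y), (R/(x))^n) is realised by the module M
  with generators g_1, ..., g_n, g and relations x g_i = 0 and y g = sum z_i g_i.  Take for the z_i
  lifts of n members of a minimal generating set of an ideal I(R/(x,y)), so that a relation
  sum a_i z_i in (x,y) forces all a_i into m.  If some z_i is a unit, then n = 1 and M is cyclic, hence indecomposable, so let
  all z_i lie in m.

  Suppose M is the direct sum of N1 and N2, and let (E_ji) be a matrix describing the projection to
  N1 on the generators.  Projecting the relation y g = sum z_i g_i shows that, modulo m, E is a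
  scalar beta on the g_i and sends no g_i to g.  If the entry of E at g is also beta modulo m, then E
  or 1 - E is triangular modulo m with units on the diagonal, and Nakayama's lemma kills N2 or N1.

  Otherwise y = sum z_i d_i with x d_i = b_i y and b_i z_k = t_ik x.  If all t_ik lie in m, Nakayama's
  lemma gives d_i in (y), hence y in m y, a contradiction.  If t_ik is a unit, then x = q z_k, every
  z_i is a multiple of z_k modulo (x,y), so n = 1, x = q z and y = d z.  Then (z, q) is a pair of
  exact zerodivisors of R/(x), and the ideal z R/(x) is totally reflexive but, being killed by q, not
  free.  This contradicts G-regularity, which is used only here.
*)
theory Submission
  imports Defs
begin

section \<open>Exact zerodivisors and G-regularity\<close>

text \<open>The matrix E is not unique, since coefficients on the generators are only defined up to
  relations, so it need not be idempotent. What can be used is that projecting a relation gives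
  another relation, and every relation is a multiple of y g = sum z_i g_i plus multiples of the x
  g_i. Projecting y g = sum z_i g_i itself therefore yields a scalar beta. Comparing coefficients at
  g shows sum E_jg z_j = (E_gg - beta) y, and at g_i, modulo (x,y), that sum_j (beta delta_ji -
  E_ji) z_j vanishes; independence of the z_j modulo (x,y) then controls all entries except those in
  the row of g. The off-diagonal entries of that row remain arbitrary, hence a triangular and not a
  scalar matrix. The diagonal entry E_gg is the real obstacle: beta meets it only through multiples
  of y, so a unit difference w has to be excluded separately. In that case d_j = E_jg / w, and b_j
  comes from projecting x g_j = 0.\<close>

lemma ring_mod_simps [simp]:
  "carrier (ring_mod A) = carrier A" "\<zero>\<^bsub>ring_mod A\<^esub> = \<zero>\<^bsub>A\<^esub>"
  "u \<oplus>\<^bsub>ring_mod A\<^esub> v = u \<oplus>\<^bsub>A\<^esub> v" "r \<odot>\<^bsub>ring_mod A\<^esub> v = r \<otimes>\<^bsub>A\<^esub> v"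
  by (simp_all add: ring_mod_def)

text \<open>Neither element is asked to be a nonunit, so 0 and 1 also form such a pair; this is why
  G-regularity will only yield that one of the two elements is zero. The annihilators are described
  elementwise so that they can be checked on representatives in a quotient ring.\<close>

locale exact_pair = cring A for A (structure) +
  fixes a b
  assumes a_carr [simp, intro]: "a \<in> carrier A" and b_carr [simp, intro]: "b \<in> carrier A"
    and ann_a: "r \<in> carrier A \<Longrightarrow> r \<otimes> a = \<zero> \<longleftrightarrow> (\<exists>c\<in>carrier A. r = b \<otimes> c)"
    and ann_b: "r \<in> carrier A \<Longrightarrow> r \<otimes> b = \<zero> \<longleftrightarrow> (\<exists>c\<in>carrier A. r = a \<otimes> c)"
begin

text \<open>Multiplication by \<open>diff_elem i\<close> is the i-th map of a 2-periodic free
  resolution of the ideal (a). It starts with b because b generates the kernel of multiplication by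
  a.\<close>

definition diff_elem :: "nat \<Rightarrow> 'a" where
  "diff_elem i = (if even i then b else a)"

lemma diff_elem_carr [simp]: "diff_elem i \<in> carrier A"
  by (simp add: diff_elem_def)

lemma ann_diff_elem:
  "r \<in> carrier A \<Longrightarrow> diff_elem i \<otimes> r = \<zero> \<longleftrightarrow> (\<exists>c\<in>carrier A. r = diff_elem (Suc i) \<otimes> c)"
  using ann_a[of r] ann_b[of r] by (simp add: diff_elem_def m_comm)

text \<open>A module generated by u with annihilator (b) is resolved by rank one free modules with
  maps b, a, b, a, ... . Dualizing replaces each map by multiplication by the same element, so the
  dual complex is exact in positive degrees for the same reason. The module laws are asked only
  along the generator, which lets the lemma serve both the ideal (a) and its dual.\<close>

lemma Ext_pos_vanish_cyclic:
  assumes carr: "carrier N = (\<lambda>r. r \<odot>\<^bsub>N\<^esub> u) ` carrier A"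
    and add: "\<And>r s. r \<in> carrier A \<Longrightarrow> s \<in> carrier A \<Longrightarrow>
      (r \<oplus> s) \<odot>\<^bsub>N\<^esub> u = r \<odot>\<^bsub>N\<^esub> u \<oplus>\<^bsub>N\<^esub> s \<odot>\<^bsub>N\<^esub> u"
    and assoc: "\<And>r s. r \<in> carrier A \<Longrightarrow> s \<in> carrier A \<Longrightarrow>
      (r \<otimes> s) \<odot>\<^bsub>N\<^esub> u = r \<odot>\<^bsub>N\<^esub> (s \<odot>\<^bsub>N\<^esub> u)"
    and ann: "\<And>r. r \<in> carrier A \<Longrightarrow> r \<odot>\<^bsub>N\<^esub> u = \<zero>\<^bsub>N\<^esub> \<longleftrightarrow> (\<exists>c\<in>carrier A. r = b \<otimes> c)"
  shows "Ext_pos_vanish A N"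
proof -
  let ?F = "power_mod (ring_mod A) (Suc 0)"
  define emb where "emb s = (\<lambda>j::nat. if j = 0 then s else \<zero>)" for s
  define eps where "eps v = v 0 \<odot>\<^bsub>N\<^esub> u" for v :: "nat \<Rightarrow> 'a"
  define d where "d i v = emb (diff_elem i \<otimes> v 0)" for i and v :: "nat \<Rightarrow> 'a"
  have F: "carrier ?F = emb ` carrier A"
  proof (intro equalityI subsetI)
    fix v assume v: "v \<in> carrier ?F"
    then have "v = emb (v 0)" by (auto simp: power_mod_def emb_def)
    moreover have "v 0 \<in> carrier A" using v by (simp add: power_mod_def)
    ultimately show "v \<in> emb ` carrier A" by blast
  qed (auto simp: power_mod_def emb_def)
  have emb0 [simp]: "emb s 0 = s" for s by (simp add: emb_def)
  have emb_eq: "emb s = emb t \<longleftrightarrow> s = t" for s t by (metis emb0)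
  have Fadd: "emb s \<oplus>\<^bsub>?F\<^esub> emb t = emb (s \<oplus> t)" for s t
    by (auto simp: power_mod_def emb_def)
  have Fsm: "r \<odot>\<^bsub>?F\<^esub> emb t = emb (r \<otimes> t)" for r t
    by (auto simp: power_mod_def emb_def)
  have Fz: "\<zero>\<^bsub>?F\<^esub> = emb \<zero>" by (auto simp: power_mod_def emb_def)
  have exact: "{v \<in> carrier ?F. d i v = \<zero>\<^bsub>?F\<^esub>} = d (Suc i) ` carrier ?F" for i
    by (auto simp: F d_def Fz emb_eq ann_diff_elem image_image)
  have "\<exists>\<psi>\<in>carrier (dual A ?F). \<forall>v\<in>carrier ?F. \<phi> v = \<psi> (d (i - 1) v)"
    if i: "1 \<le> i" and \<phi>: "\<phi> \<in> carrier (dual A ?F)" and z: "\<forall>v\<in>carrier ?F. \<phi> (d i v) = \<zero>" for i \<phi>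
  proof -
    \<comment> \<open>A functional on a rank one free module is multiplication by its value at 1,
      and the cocycle condition says that \<open>diff_elem i\<close> kills this value.\<close>
    define c where "c = \<phi> (emb \<one>)"
    have c: "c \<in> carrier A"
      using \<phi> by (auto simp: dual_def mod_hom_def F c_def)
    have lin: "\<phi> (emb r) = r \<otimes> c" if "r \<in> carrier A" for r
    proof -
      have "\<phi> (r \<odot>\<^bsub>?F\<^esub> emb \<one>) = r \<otimes> \<phi> (emb \<one>)"
        using \<phi> that by (auto simp: dual_def mod_hom_def F)
      with that show ?thesis by (simp add: Fsm c_def)
    qed
    have "\<phi> (d i (emb \<one>)) = \<zero>" using z F by blast
    then have "diff_elem i \<otimes> c = \<zero>" by (simp add: d_def lin)
    then obtain c' where c': "c' \<in> carrier A" "c = diff_elem (Suc i) \<otimes> c'"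
      using ann_diff_elem[OF c] by blast
    \<comment> \<open>Since \<open>i\<close> is at least 1, the indices \<open>i - 1\<close> and
      \<open>Suc i\<close> really differ by two and carry the same element; so c is a multiple of
      the element defining \<open>d (i - 1)\<close>.\<close>
    have par: "diff_elem (Suc i) = diff_elem (i - 1)"
      using i by (cases i) (auto simp: diff_elem_def)
    define \<psi> where "\<psi> = (\<lambda>v\<in>carrier ?F. v 0 \<otimes> c')"
    have "\<psi> \<in> carrier (dual A ?F)"
      by (auto simp: \<psi>_def dual_def mod_hom_def F Fadd Fsm c'(1) l_distr m_assoc)
    moreover have "\<forall>v\<in>carrier ?F. \<phi> v = \<psi> (d (i - 1) v)"
      using c' by (auto simp: \<psi>_def F d_def lin par m_ac)
    ultimately show ?thesis by blast
  qed
  then show ?thesis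
    unfolding Ext_pos_vanish_def
    apply (intro exI[of _ "\<lambda>_. Suc 0"] exI[of _ eps] exI[of _ d] conjI)
    subgoal by (auto simp: mod_hom_def F Fadd Fsm eps_def carr add assoc)
    subgoal by (auto simp: F eps_def carr image_image)
    subgoal by (auto simp: mod_hom_def F Fadd Fsm d_def r_distr l_distr m_ac)
    subgoal by (auto simp: F d_def eps_def ann emb_eq diff_elem_def image_image)
    subgoal using exact by blast
    subgoal by blast
    done
qed

text \<open>The ideal generated by \<open>a\<close>, its elements \<open>s\<close> being stored as the singletons of the constant
  sequences \<open>s\<close>, so that it lives in the type over which G-regularity quantifies.\<close>
definition ideal_copy :: "('a, (nat \<Rightarrow> 'a) set) module" where
  "ideal_copy = \<lparr>partial_object.carrier = (\<lambda>r. {\<lambda>_. r \<otimes> a}) ` carrier A,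
    monoid.mult = (\<lambda>_ _. {}), monoid.one = {}, ring.zero = {\<lambda>_. \<zero>},
    ring.add = (\<lambda>S T. {\<lambda>_. the_elem S 0 \<oplus> the_elem T 0}),
    module.smult = (\<lambda>r S. {\<lambda>_. r \<otimes> the_elem S 0})\<rparr>"

abbreviation (input) cst :: "'a \<Rightarrow> (nat \<Rightarrow> 'a) set" where "cst s \<equiv> {\<lambda>_. s}"

lemma carrier_ideal_copy: "carrier ideal_copy = (\<lambda>r. cst (r \<otimes> a)) ` carrier A"
  by (simp add: ideal_copy_def)

lemma cst_in_ideal_copy [simp]: "r \<in> carrier A \<Longrightarrow> cst (r \<otimes> a) \<in> carrier ideal_copy"
  by (auto simp: carrier_ideal_copy)

lemma ideal_copyE:
  assumes "u \<in> carrier ideal_copy"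
  obtains r where "r \<in> carrier A" "u = cst (r \<otimes> a)"
  using assms by (auto simp: carrier_ideal_copy)

lemma ideal_copy_simps [simp]:
  "\<zero>\<^bsub>ideal_copy\<^esub> = cst \<zero>"
  "cst s \<oplus>\<^bsub>ideal_copy\<^esub> cst t = cst (s \<oplus> t)"
  "r \<odot>\<^bsub>ideal_copy\<^esub> cst t = cst (r \<otimes> t)"
  by (simp_all add: ideal_copy_def)

lemma cst_eq: "(\<lambda>_::nat. s) = (\<lambda>_. t) \<longleftrightarrow> s = t"
  by (simp add: fun_eq_iff)

lemma module_ideal_copy: "module A ideal_copy"
proof (rule moduleI)
  show "abelian_group ideal_copy"
  proof (rule abelian_groupI)
    fix u assume "u \<in> carrier ideal_copy"
    then obtain r where r: "r \<in> carrier A" "u = cst (r \<otimes> a)" by (rule ideal_copyE)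
    then have "cst ((\<ominus> r) \<otimes> a) \<oplus>\<^bsub>ideal_copy\<^esub> u = \<zero>\<^bsub>ideal_copy\<^esub>"
      by (simp add: l_minus l_neg)
    then show "\<exists>v\<in>carrier ideal_copy. v \<oplus>\<^bsub>ideal_copy\<^esub> u = \<zero>\<^bsub>ideal_copy\<^esub>"
      using r cst_in_ideal_copy[of "\<ominus> r"] by blast
  next
    fix u v assume "u \<in> carrier ideal_copy" "v \<in> carrier ideal_copy"
    then obtain r s where "r \<in> carrier A" "s \<in> carrier A" "u = cst (r \<otimes> a)" "v = cst (s \<otimes> a)"
      by (metis ideal_copyE)
    then show "u \<oplus>\<^bsub>ideal_copy\<^esub> v \<in> carrier ideal_copy"
      using cst_in_ideal_copy[of "r \<oplus> s"] by (simp add: l_distr)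
  next
    show "\<zero>\<^bsub>ideal_copy\<^esub> \<in> carrier ideal_copy"
      using cst_in_ideal_copy[of \<zero>] by simp
  qed (auto simp: a_ac carrier_ideal_copy)
next
  fix r u assume "r \<in> carrier A" "u \<in> carrier ideal_copy"
  then obtain s where "r \<in> carrier A" "s \<in> carrier A" "u = cst (s \<otimes> a)" by (metis ideal_copyE)
  then show "r \<odot>\<^bsub>ideal_copy\<^esub> u \<in> carrier ideal_copy"
    using cst_in_ideal_copy[of "r \<otimes> s"] by (simp add: m_assoc)
qed (auto simp: is_cring l_distr r_distr m_assoc carrier_ideal_copy)

text \<open>The inclusion of the ideal (a) into A, which turns out to generate the dual. It is
  restricted because the elements of \<open>dual\<close> are extensional functions.\<close>

definition incl :: "(nat \<Rightarrow> 'a) set \<Rightarrow> 'a" where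
  "incl = (\<lambda>S\<in>carrier ideal_copy. the_elem S 0)"

lemma incl_cst [simp]: "r \<in> carrier A \<Longrightarrow> incl (cst (r \<otimes> a)) = r \<otimes> a"
  by (simp add: incl_def)

lemma gen_in_ideal_copy: "cst a \<in> carrier ideal_copy"
  using cst_in_ideal_copy[of \<one>] by simp

lemma dual_ideal_copy_lin:
  assumes "\<phi> \<in> carrier (dual A ideal_copy)" "r \<in> carrier A"
  shows "\<phi> (cst (r \<otimes> a)) = r \<otimes> \<phi> (cst a)"
proof -
  have "\<phi> (r \<odot>\<^bsub>ideal_copy\<^esub> cst a) = r \<otimes> \<phi> (cst a)"
    using assms gen_in_ideal_copy by (simp add: dual_def mod_hom_def del: ideal_copy_simps)
  then show ?thesis by simp
qed

lemma dual_ideal_copy_closed: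
  "\<phi> \<in> carrier (dual A ideal_copy) \<Longrightarrow> \<phi> (cst a) \<in> carrier A"
  using gen_in_ideal_copy by (auto simp: dual_def mod_hom_def)

lemma dual_ideal_copy_ext:
  assumes "\<phi> \<in> carrier (dual A ideal_copy)" "\<psi> \<in> carrier (dual A ideal_copy)" "\<phi> (cst a) = \<psi> (cst a)"
  shows "\<phi> = \<psi>"
proof (rule extensionalityI)
  fix S assume "S \<in> carrier ideal_copy"
  then show "\<phi> S = \<psi> S" using assms by (auto simp: dual_ideal_copy_lin elim!: ideal_copyE)
qed (use assms in \<open>auto simp: dual_def\<close>)

lemma smult_incl:
  assumes "r \<in> carrier A"
  shows "r \<odot>\<^bsub>dual A ideal_copy\<^esub> incl \<in> carrier (dual A ideal_copy)"
    and "(r \<odot>\<^bsub>dual A ideal_copy\<^esub> incl) (cst a) = r \<otimes> a"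
proof -
  have *: "r \<odot>\<^bsub>dual A ideal_copy\<^esub> incl = (\<lambda>S\<in>carrier ideal_copy. r \<otimes> the_elem S 0)"
    by (auto simp: dual_def incl_def)
  interpret M: module A ideal_copy by (rule module_ideal_copy)
  have [simp]: "the_elem u 0 \<in> carrier A"
      "the_elem (u \<oplus>\<^bsub>ideal_copy\<^esub> v) 0 = the_elem u 0 \<oplus> the_elem v 0"
      "the_elem (s \<odot>\<^bsub>ideal_copy\<^esub> u) 0 = s \<otimes> the_elem u 0"
    if "u \<in> carrier ideal_copy" "v \<in> carrier ideal_copy" "s \<in> carrier A" for u v s
    using that by (auto elim!: ideal_copyE)
  then show "r \<odot>\<^bsub>dual A ideal_copy\<^esub> incl \<in> carrier (dual A ideal_copy)"
    unfolding * using assms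
    by (auto simp: dual_def mod_hom_def r_distr m_ac intro: M.smult_closed)
  show "(r \<odot>\<^bsub>dual A ideal_copy\<^esub> incl) (cst a) = r \<otimes> a"
    using gen_in_ideal_copy unfolding * by simp
qed

text \<open>A functional is determined by its value at a. As b a = 0, this value is killed by b,
  hence equals c a for some c, and the functional is c times the inclusion.\<close>

lemma carrier_dual_ideal_copy:
  "carrier (dual A ideal_copy) = (\<lambda>r. r \<odot>\<^bsub>dual A ideal_copy\<^esub> incl) ` carrier A"
proof (intro equalityI subsetI)
  fix \<phi> assume \<phi>: "\<phi> \<in> carrier (dual A ideal_copy)"
  have "b \<otimes> \<phi> (cst a) = \<phi> (cst (b \<otimes> a))" using \<phi> by (simp add: dual_ideal_copy_lin)
  also have "b \<otimes> a = \<zero> \<otimes> a" using ann_a[of b] by (auto intro: bexI[of _ \<one>])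
  also have "\<phi> (cst \<dots>) = \<zero>" using \<phi> dual_ideal_copy_lin[OF \<phi>, of \<zero>] dual_ideal_copy_closed[OF \<phi>] by simp
  finally have "\<phi> (cst a) \<otimes> b = \<zero>" using dual_ideal_copy_closed[OF \<phi>] by (simp add: m_comm)
  then obtain c where c: "c \<in> carrier A" "\<phi> (cst a) = a \<otimes> c"
    using ann_b dual_ideal_copy_closed[OF \<phi>] by blast
  then have "\<phi> = c \<odot>\<^bsub>dual A ideal_copy\<^esub> incl"
    by (intro dual_ideal_copy_ext \<phi> smult_incl) (simp_all add: smult_incl m_comm)
  with c show "\<phi> \<in> (\<lambda>r. r \<odot>\<^bsub>dual A ideal_copy\<^esub> incl) ` carrier A" by blast
qed (use smult_incl in auto)

lemma smult_incl_eq_zero_iff: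
  assumes "r \<in> carrier A"
  shows "r \<odot>\<^bsub>dual A ideal_copy\<^esub> incl = \<zero>\<^bsub>dual A ideal_copy\<^esub> \<longleftrightarrow> r \<otimes> a = \<zero>"
proof
  assume "r \<odot>\<^bsub>dual A ideal_copy\<^esub> incl = \<zero>\<^bsub>dual A ideal_copy\<^esub>"
  then have "r \<otimes> a = \<zero>\<^bsub>dual A ideal_copy\<^esub> (cst a)" using smult_incl(2)[OF assms] by simp
  also have "\<dots> = \<zero>" using gen_in_ideal_copy by (simp add: dual_def)
  finally show "r \<otimes> a = \<zero>" .
next
  assume "r \<otimes> a = \<zero>"
  then have "r \<otimes> (s \<otimes> a) = \<zero>" if "s \<in> carrier A" for s
    using that assms by (metis a_carr m_lcomm r_null)
  then show "r \<odot>\<^bsub>dual A ideal_copy\<^esub> incl = \<zero>\<^bsub>dual A ideal_copy\<^esub>"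
    by (auto simp: dual_def elim!: ideal_copyE intro!: restrict_ext)
qed

lemma smult_incl_add:
  assumes "r \<in> carrier A" "s \<in> carrier A"
  shows "(r \<odot>\<^bsub>dual A ideal_copy\<^esub> incl) \<oplus>\<^bsub>dual A ideal_copy\<^esub> (s \<odot>\<^bsub>dual A ideal_copy\<^esub> incl)
      = (r \<oplus> s) \<odot>\<^bsub>dual A ideal_copy\<^esub> incl"
    and smult_incl_smult: "r \<odot>\<^bsub>dual A ideal_copy\<^esub> (s \<odot>\<^bsub>dual A ideal_copy\<^esub> incl)
      = (r \<otimes> s) \<odot>\<^bsub>dual A ideal_copy\<^esub> incl"
    using assms by (auto simp: dual_def l_distr m_assoc elim!: ideal_copyE intro!: restrict_ext)

text \<open>The argument for the dual repeats itself one level up: a functional on the dual is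
  determined by its value at \<open>incl\<close>, and b kills \<open>incl\<close>, so this value is
  c a and the functional is evaluation at c a. Injectivity follows by evaluating at
  \<open>incl\<close>.\<close>

lemma bidual_ideal_copy:
  "bij_betw (\<lambda>u. \<lambda>f\<in>carrier (dual A ideal_copy). f u) (carrier ideal_copy)
    (carrier (dual A (dual A ideal_copy)))"
proof -
  let ?D = "dual A ideal_copy"
  define ev where "ev u = (\<lambda>f\<in>carrier ?D. f u)" for u
  have incl: "incl \<in> carrier ?D"
  proof -
    have "incl = \<one> \<odot>\<^bsub>?D\<^esub> incl" unfolding incl_def by (auto simp: dual_def elim!: ideal_copyE intro!: restrict_ext)
    then show ?thesis using smult_incl(1)[OF one_closed] by simp
  qed
  have ev_incl: "ev u incl = the_elem u 0" if "u \<in> carrier ideal_copy" for u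
    using that incl by (simp add: ev_def incl_def)
  have Dev: "(r \<odot>\<^bsub>?D\<^esub> incl) u = r \<otimes> the_elem u 0" if "u \<in> carrier ideal_copy" for r u
    using that by (simp add: dual_def incl_def)
  have "ev u \<in> carrier (dual A ?D)" if u: "u \<in> carrier ideal_copy" for u
  proof -
    have "the_elem u 0 \<in> carrier A" using u by (auto elim!: ideal_copyE)
    moreover have "ev u (r \<odot>\<^bsub>?D\<^esub> incl) = r \<otimes> the_elem u 0" if "r \<in> carrier A" for r
      unfolding ev_def using Dev[OF u] smult_incl(1)[OF that] by simp
    ultimately have "ev u \<in> mod_hom A ?D (ring_mod A)"
      unfolding mod_hom_def carrier_dual_ideal_copy by (auto simp: smult_incl_add smult_incl_smult l_distr m_assoc)
    then show ?thesis by (simp add: dual_def[of A ?D] ev_def)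
  qed
  moreover have "inj_on ev (carrier ideal_copy)"
  proof (rule inj_onI)
    fix u v assume *: "u \<in> carrier ideal_copy" "v \<in> carrier ideal_copy" "ev u = ev v"
    then have "the_elem u 0 = the_elem v 0" using ev_incl by metis
    with * show "u = v" by (auto elim!: ideal_copyE)
  qed
  moreover have "\<Phi> \<in> ev ` carrier ideal_copy" if \<Phi>: "\<Phi> \<in> carrier (dual A ?D)" for \<Phi>
  proof -
    have lin: "\<Phi> (r \<odot>\<^bsub>?D\<^esub> incl) = r \<otimes> \<Phi> incl" if "r \<in> carrier A" for r
      using \<Phi> incl that by (simp add: dual_def[of A ?D] mod_hom_def)
    have cl: "\<Phi> incl \<in> carrier A"
      using \<Phi> incl by (auto simp: dual_def[of A ?D] mod_hom_def)
    have "b \<otimes> \<Phi> incl = \<Phi> (b \<odot>\<^bsub>?D\<^esub> incl)" by (simp add: lin)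
    also have "b \<odot>\<^bsub>?D\<^esub> incl = \<zero> \<odot>\<^bsub>?D\<^esub> incl"
      using smult_incl_eq_zero_iff[of b] smult_incl_eq_zero_iff[of \<zero>] ann_a[of b]
      by (auto intro: bexI[of _ \<one>])
    also have "\<Phi> \<dots> = \<zero>" using cl by (simp add: lin)
    finally have "\<Phi> incl \<otimes> b = \<zero>" using cl by (simp add: m_comm)
    then obtain c where c: "c \<in> carrier A" "\<Phi> incl = c \<otimes> a"
      using ann_b[OF cl] m_comm by auto
    then have mem: "cst (c \<otimes> a) \<in> carrier ideal_copy" by (simp add: cst_in_ideal_copy)
    have "\<Phi> = ev (cst (c \<otimes> a))"
    proof (rule extensionalityI[where A = "carrier ?D"])
      fix f assume "f \<in> carrier ?D"
      then obtain r where "r \<in> carrier A" "f = r \<odot>\<^bsub>?D\<^esub> incl"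
        unfolding carrier_dual_ideal_copy by blast
      then show "\<Phi> f = ev (cst (c \<otimes> a)) f"
        using smult_incl(1) by (simp add: ev_def lin c Dev[OF mem])
    qed (use \<Phi> in \<open>auto simp: ev_def dual_def[of A ?D]\<close>)
    with mem show ?thesis by blast
  qed
  ultimately show ?thesis
    unfolding bij_betw_def ev_def[symmetric] by blast
qed

text \<open>The ideal (a) and its dual are both cyclic with annihilator (b), so one periodic
  resolution settles both Ext conditions.\<close>

lemma totally_reflexive_ideal_copy: "totally_reflexive A ideal_copy"
proof -
  have "generates A ideal_copy {cst a}"
    unfolding generates_def
  proof (intro conjI allI impI subsetI)
    fix H u assume H: "submodule H A ideal_copy \<and> {cst a} \<subseteq> H" and "u \<in> carrier ideal_copy"
    then obtain r where r: "r \<in> carrier A" "u = cst (r \<otimes> a)" by (metis ideal_copyE)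
    then have "r \<odot>\<^bsub>ideal_copy\<^esub> cst a \<in> H" using H by (intro submodule.smult_closed) auto
    with r show "u \<in> H" by simp
  qed (use gen_in_ideal_copy in auto)
  then have "fin_gen A ideal_copy" unfolding fin_gen_def by blast
  moreover have "Ext_pos_vanish A ideal_copy"
    by (rule Ext_pos_vanish_cyclic[where u = "cst a"])
      (auto simp: l_distr m_assoc cst_eq ann_a carrier_ideal_copy)
  moreover have "Ext_pos_vanish A (dual A ideal_copy)"
  proof (rule Ext_pos_vanish_cyclic[where u = "incl"])
    show "carrier (dual A ideal_copy) = (\<lambda>r. r \<odot>\<^bsub>dual A ideal_copy\<^esub> incl) ` carrier A"
      by (rule carrier_dual_ideal_copy)
  qed (simp_all add: smult_incl_eq_zero_iff ann_a smult_incl_add smult_incl_smult)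
  ultimately show ?thesis
    unfolding totally_reflexive_def using module_ideal_copy bidual_ideal_copy by blast
qed

text \<open>The ideal generated by \<open>a\<close> is killed by \<open>b\<close>, so it is free only in degenerate cases.\<close>
lemma G_regular_imp_trivial:
  assumes "G_regular A"
  shows "a = \<zero> \<or> b = \<zero>"
proof -
  let ?F = "power_mod (ring_mod A)"
  obtain n f where f: "f \<in> mod_hom A (?F n) ideal_copy" "bij_betw f (carrier (?F n)) (carrier ideal_copy)"
    using assms totally_reflexive_ideal_copy unfolding G_regular_def free_fg_def by blast
  have f0: "f (\<lambda>_. \<zero>) = cst \<zero>"
  proof -
    have z: "(\<lambda>_. \<zero>) \<in> carrier (?F n)" "\<zero> \<odot>\<^bsub>?F n\<^esub> (\<lambda>_. \<zero>) = (\<lambda>_. \<zero>)"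
      by (auto simp: power_mod_def)
    have "f (\<zero> \<odot>\<^bsub>?F n\<^esub> (\<lambda>_. \<zero>)) = \<zero> \<odot>\<^bsub>ideal_copy\<^esub> f (\<lambda>_. \<zero>)"
      using f(1) z(1) by (auto simp: mod_hom_def)
    moreover have "f (\<lambda>_. \<zero>) \<in> carrier ideal_copy" using f(1) z(1) by (auto simp: mod_hom_def)
    moreover from this obtain r where r: "r \<in> carrier A" "f (\<lambda>_. \<zero>) = cst (r \<otimes> a)" by (rule ideal_copyE)
    ultimately have "f (\<lambda>_. \<zero>) = \<zero> \<odot>\<^bsub>ideal_copy\<^esub> cst (r \<otimes> a)" using z(2) by metis
    with r(1) show ?thesis by simp
  qed
  show ?thesis
  proof (cases n)
    case 0
    then have "carrier (?F n) = {\<lambda>_. \<zero>}" by (auto simp: power_mod_def)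
    then have "carrier ideal_copy = {cst \<zero>}"
      using f(2) f0 by (simp add: bij_betw_def)
    then have "cst a = cst \<zero>" using gen_in_ideal_copy by blast
    then show ?thesis by (simp add: cst_eq)
  next
    case (Suc k)
    \<comment> \<open>The first basis vector, available because the rank is positive. The map
      \<open>f\<close> sends b e to b times an element of (a), which is 0; injectivity gives b e =
      0, and the first coordinate of b e is b.\<close>
    define e where "e = (\<lambda>i::nat. if i = 0 then \<one> else \<zero>)"
    have e: "e \<in> carrier (?F n)" and be: "b \<odot>\<^bsub>?F n\<^esub> e \<in> carrier (?F n)" "(b \<odot>\<^bsub>?F n\<^esub> e) 0 = b"
      and z: "(\<lambda>_. \<zero>) \<in> carrier (?F n)"
      using Suc by (auto simp: power_mod_def e_def)
    have "f e \<in> carrier ideal_copy" using f(1) e by (auto simp: mod_hom_def)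
    then obtain r where r: "r \<in> carrier A" "f e = cst (r \<otimes> a)" by (rule ideal_copyE)
    have "b \<otimes> a = \<zero>" using ann_a[of b] by (auto intro: bexI[of _ \<one>])
    then have ba: "b \<otimes> (r \<otimes> a) = \<zero>" using r by (metis a_carr b_carr m_lcomm r_null)
    have "f (b \<odot>\<^bsub>?F n\<^esub> e) = b \<odot>\<^bsub>ideal_copy\<^esub> f e" using f(1) e by (simp add: mod_hom_def)
    also have "\<dots> = f (\<lambda>_. \<zero>)" using r f0 ba by simp
    finally have "b \<odot>\<^bsub>?F n\<^esub> e = (\<lambda>_. \<zero>)"
      by (rule inj_onD[OF bij_betw_imp_inj_on[OF f(2)] _ be(1) z])
    with be(2) show ?thesis by simp
  qed
qed

end

section \<open>A triangular form of Nakayama's lemma\<close>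

lemma (in cring) module_ring_mod: "module R (ring_mod R)"
proof (rule moduleI)
  show "abelian_group (ring_mod R)"
    by (rule abelian_groupI) (auto simp: a_ac intro: exI l_neg bexI[of _ "\<ominus> _"])
qed (auto simp: is_cring l_distr r_distr m_assoc)

lemma (in cring) minus_ring_mod:
  assumes "a \<in> carrier R" "b \<in> carrier R"
  shows "a \<ominus>\<^bsub>ring_mod R\<^esub> b = a \<ominus> b"
proof -
  interpret RM: module R "ring_mod R" by (rule module_ring_mod)
  show ?thesis
    using assms RM.M.minus_equality[of "\<ominus> b" b] by (simp add: l_neg a_minus_def)
qed

lemma finsum_ring_mod: "finsum (ring_mod A) = finsum A"
  by (simp add: finsum_def finprod_def fun_eq_iff ring_mod_def)

context module
begin

lemma submodule_finsum_closed:
  assumes "submodule N R M" "finite K" "\<And>k. k \<in> K \<Longrightarrow> f k \<in> N"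
  shows "(\<Oplus>\<^bsub>M\<^esub>k\<in>K. f k) \<in> N"
  using assms(2,3)
proof (induction K)
  case empty
  show ?case using submoduleE[OF assms(1)] subgroup.one_closed[OF submodule.axioms(1)[OF assms(1)]] by simp
next
  case (insert k K)
  then have "f \<in> insert k K \<rightarrow> carrier M" using submoduleE(1)[OF assms(1)] by blast
  with insert show ?case using submoduleE(5)[OF assms(1)] by (simp add: Pi_def)
qed

lemma submodule_zero: "submodule {\<zero>\<^bsub>M\<^esub>} R M"
  by (rule submoduleI) auto

lemma submodule_add_smult:
  assumes N: "submodule N R M" and I: "ideal I R" and h: "h \<in> carrier M"
  shows "submodule {\<nu> \<oplus>\<^bsub>M\<^esub> s \<odot>\<^bsub>M\<^esub> h | \<nu> s. \<nu> \<in> N \<and> s \<in> I} R M"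
proof -
  interpret I: ideal I R by fact
  note N' = submoduleE[OF N]
  have z: "\<zero>\<^bsub>M\<^esub> \<in> N" using subgroup.one_closed[OF submodule.axioms(1)[OF N]] by simp
  show ?thesis
  proof (rule submoduleI)
    show "{\<nu> \<oplus>\<^bsub>M\<^esub> s \<odot>\<^bsub>M\<^esub> h | \<nu> s. \<nu> \<in> N \<and> s \<in> I} \<subseteq> carrier M"
      using N'(1) h by auto
    show "\<zero>\<^bsub>M\<^esub> \<in> {\<nu> \<oplus>\<^bsub>M\<^esub> s \<odot>\<^bsub>M\<^esub> h | \<nu> s. \<nu> \<in> N \<and> s \<in> I}"
      using z h by (auto intro!: exI[of _ "\<zero>\<^bsub>M\<^esub>"] exI[of _ "\<zero>\<^bsub>R\<^esub>"])
    fix u assume "u \<in> {\<nu> \<oplus>\<^bsub>M\<^esub> s \<odot>\<^bsub>M\<^esub> h | \<nu> s. \<nu> \<in> N \<and> s \<in> I}"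
    then obtain \<nu> s where u: "\<nu> \<in> N" "s \<in> I" "u = \<nu> \<oplus>\<^bsub>M\<^esub> s \<odot>\<^bsub>M\<^esub> h" by blast
    then have c: "\<nu> \<in> carrier M" "s \<in> carrier R" using N'(1) by auto
    then have "\<ominus>\<^bsub>M\<^esub> u = \<ominus>\<^bsub>M\<^esub> \<nu> \<oplus>\<^bsub>M\<^esub> (\<ominus> s) \<odot>\<^bsub>M\<^esub> h"
      using u(3) h by (simp add: M.minus_add smult_l_minus)
    then show "\<ominus>\<^bsub>M\<^esub> u \<in> {\<nu> \<oplus>\<^bsub>M\<^esub> s \<odot>\<^bsub>M\<^esub> h | \<nu> s. \<nu> \<in> N \<and> s \<in> I}"
      using u N'(3) by blast
    { fix v assume "v \<in> {\<nu> \<oplus>\<^bsub>M\<^esub> s \<odot>\<^bsub>M\<^esub> h | \<nu> s. \<nu> \<in> N \<and> s \<in> I}"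
      then obtain \<nu>' s' where v: "\<nu>' \<in> N" "s' \<in> I" "v = \<nu>' \<oplus>\<^bsub>M\<^esub> s' \<odot>\<^bsub>M\<^esub> h" by blast
      then have "\<nu>' \<in> carrier M" "s' \<in> carrier R" using N'(1) by auto
      then have "u \<oplus>\<^bsub>M\<^esub> v = (\<nu> \<oplus>\<^bsub>M\<^esub> \<nu>') \<oplus>\<^bsub>M\<^esub> (s \<oplus> s') \<odot>\<^bsub>M\<^esub> h"
        using u v c h by (simp add: smult_l_distr M.a_ac)
      then show "u \<oplus>\<^bsub>M\<^esub> v \<in> {\<nu> \<oplus>\<^bsub>M\<^esub> s \<odot>\<^bsub>M\<^esub> h | \<nu> s. \<nu> \<in> N \<and> s \<in> I}"
        using u v N'(5) by blast }
    { fix r assume r: "r \<in> carrier R"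
      then have "r \<odot>\<^bsub>M\<^esub> u = r \<odot>\<^bsub>M\<^esub> \<nu> \<oplus>\<^bsub>M\<^esub> (r \<otimes> s) \<odot>\<^bsub>M\<^esub> h"
        using u c h by (simp add: smult_r_distr smult_assoc1)
      then show "r \<odot>\<^bsub>M\<^esub> u \<in> {\<nu> \<oplus>\<^bsub>M\<^esub> s \<odot>\<^bsub>M\<^esub> h | \<nu> s. \<nu> \<in> N \<and> s \<in> I}"
        using u N'(4)[OF r] I.I_l_closed[OF _ r] by blast }
  qed
qed

text \<open>Row j of the matrix r - c applied to the vector h. It is used with r = 1 to set up
  Nakayama's lemma and with r = \<beta> to compare E with a scalar matrix.\<close>

lemma finsum_delta_minus:
  assumes j: "j < (n::nat)" and r: "r \<in> carrier R" and c: "\<And>k. k < n \<Longrightarrow> c k \<in> carrier R" and h: "\<And>k. k < n \<Longrightarrow> h k \<in> carrier M"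
  shows "(\<Oplus>\<^bsub>M\<^esub>k\<in>{..<n}. ((if k = j then r else \<zero>) \<ominus> c k) \<odot>\<^bsub>M\<^esub> h k)
    = r \<odot>\<^bsub>M\<^esub> h j \<ominus>\<^bsub>M\<^esub> (\<Oplus>\<^bsub>M\<^esub>k\<in>{..<n}. c k \<odot>\<^bsub>M\<^esub> h k)"
proof -
  let ?\<delta> = "\<lambda>k. if k = j then r else \<zero>"
  have "(\<Oplus>\<^bsub>M\<^esub>k\<in>{..<n}. (?\<delta> k \<ominus> c k) \<odot>\<^bsub>M\<^esub> h k) \<oplus>\<^bsub>M\<^esub> (\<Oplus>\<^bsub>M\<^esub>k\<in>{..<n}. c k \<odot>\<^bsub>M\<^esub> h k)
      = (\<Oplus>\<^bsub>M\<^esub>k\<in>{..<n}. (?\<delta> k \<ominus> c k) \<odot>\<^bsub>M\<^esub> h k \<oplus>\<^bsub>M\<^esub> c k \<odot>\<^bsub>M\<^esub> h k)"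
    using c h r by (intro M.finsum_addf[symmetric]) auto
  also have "\<dots> = (\<Oplus>\<^bsub>M\<^esub>k\<in>{..<n}. if j = k then r \<odot>\<^bsub>M\<^esub> h k else \<zero>\<^bsub>M\<^esub>)"
  proof (rule M.finsum_cong')
    fix k assume "k \<in> {..<n}"
    then have k: "c k \<in> carrier R" "h k \<in> carrier M" using c h r by auto
    then have "(?\<delta> k \<ominus> c k) \<odot>\<^bsub>M\<^esub> h k \<oplus>\<^bsub>M\<^esub> c k \<odot>\<^bsub>M\<^esub> h k = ((?\<delta> k \<ominus> c k) \<oplus> c k) \<odot>\<^bsub>M\<^esub> h k"
      using r by (simp add: smult_l_distr)
    also have "(?\<delta> k \<ominus> c k) \<oplus> c k = ?\<delta> k"
      using k r by (simp add: R.minus_eq R.a_assoc R.l_neg)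
    finally show "(?\<delta> k \<ominus> c k) \<odot>\<^bsub>M\<^esub> h k \<oplus>\<^bsub>M\<^esub> c k \<odot>\<^bsub>M\<^esub> h k = (if j = k then r \<odot>\<^bsub>M\<^esub> h k else \<zero>\<^bsub>M\<^esub>)"
      using k r by auto
  qed (use h r in auto)
  also have "\<dots> = r \<odot>\<^bsub>M\<^esub> h j" using j h r by (intro M.finsum_singleton) auto
  finally have eq: "(\<Oplus>\<^bsub>M\<^esub>k\<in>{..<n}. (?\<delta> k \<ominus> c k) \<odot>\<^bsub>M\<^esub> h k) \<oplus>\<^bsub>M\<^esub> (\<Oplus>\<^bsub>M\<^esub>k\<in>{..<n}. c k \<odot>\<^bsub>M\<^esub> h k) = r \<odot>\<^bsub>M\<^esub> h j" .
  have "(\<Oplus>\<^bsub>M\<^esub>k\<in>{..<n}. (?\<delta> k \<ominus> c k) \<odot>\<^bsub>M\<^esub> h k) \<in> carrier M"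
    "(\<Oplus>\<^bsub>M\<^esub>k\<in>{..<n}. c k \<odot>\<^bsub>M\<^esub> h k) \<in> carrier M"
    using c h r by (auto intro!: M.finsum_closed)
  then show ?thesis
    unfolding eq[symmetric] by (simp add: M.minus_eq M.a_assoc M.r_neg)
qed

end

text \<open>Locality enters the algebra below only in the form that the nonunits are exactly the
  elements of an ideal.\<close>

locale local_cring = cring R for R (structure) +
  fixes m
  assumes ideal_m: "ideal m R"
    and Units_iff: "a \<in> carrier R \<Longrightarrow> a \<in> Units R \<longleftrightarrow> a \<notin> m"
begin

sublocale m: ideal m R by (rule ideal_m)

lemma Units_minus:
  assumes "a \<in> Units R" "s \<in> m"
  shows "a \<ominus> s \<in> Units R"
proof (rule ccontr)
  assume "a \<ominus> s \<notin> Units R"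
  then have "a \<ominus> s \<in> m" using assms Units_iff by auto
  then have "(a \<ominus> s) \<oplus> s \<in> m" using assms by blast
  moreover have "(a \<ominus> s) \<oplus> s = a" using assms by (simp add: minus_eq a_assoc l_neg Units_closed m.Icarr)
  ultimately show False using assms Units_iff by auto
qed

text \<open>Elimination of the last element instead of a determinant. Modulo N + m h_n the first
  rows involve only the earlier h_j, so by induction those lie in N + m h_n. The last row then gives
  F_nn h_n = \<nu> + s h_n with \<nu> in N and s in m, and F_nn - s is a unit.\<close>

lemma nakayama_triangular:
  fixes F :: "nat \<Rightarrow> nat \<Rightarrow> 'a"
  assumes M: "module R M" and N: "submodule N R M"
    and h: "\<And>j. j < n \<Longrightarrow> h j \<in> carrier M"
    and F: "\<And>j k. j < n \<Longrightarrow> k < n \<Longrightarrow> F j k \<in> carrier R"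
    and diag: "\<And>j. j < n \<Longrightarrow> F j j \<in> Units R"
    and upper: "\<And>j k. j < k \<Longrightarrow> k < n \<Longrightarrow> F j k \<in> m"
    and row: "\<And>j. j < n \<Longrightarrow> (\<Oplus>\<^bsub>M\<^esub>k\<in>{..<n}. F j k \<odot>\<^bsub>M\<^esub> h k) \<in> N"
  shows "\<forall>j<n. h j \<in> N"
  using N h F diag upper row
proof (induction n arbitrary: N)
  case 0
  then show ?case by simp
next
  case (Suc n)
  interpret module R M by (rule M)
  note N = submoduleE[OF Suc.prems(1)]
  have hn: "h n \<in> carrier M" by (simp add: Suc.prems)
  define N' where "N' = {\<nu> \<oplus>\<^bsub>M\<^esub> s \<odot>\<^bsub>M\<^esub> h n | \<nu> s. \<nu> \<in> N \<and> s \<in> m}"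
  have sub: "submodule N' R M"
    unfolding N'_def by (rule submodule_add_smult[OF Suc.prems(1) ideal_m hn])
  note N' = submoduleE[OF sub]
  have z: "\<zero>\<^bsub>M\<^esub> \<in> N" using subgroup.one_closed[OF submodule.axioms(1)[OF Suc.prems(1)]] by simp
  have NN': "\<nu> \<in> N'" if "\<nu> \<in> N" for \<nu>
    unfolding N'_def using that N(1) hn by (auto intro!: exI[of _ \<nu>] exI[of _ \<zero>])
  have mN': "s \<odot>\<^bsub>M\<^esub> h n \<in> N'" if "s \<in> m" for s
    unfolding N'_def using that z hn by (auto intro!: exI[of _ "\<zero>\<^bsub>M\<^esub>"] exI[of _ s])
  have split: "(\<Oplus>\<^bsub>M\<^esub>k\<in>{..<Suc n}. F j k \<odot>\<^bsub>M\<^esub> h k) = F j n \<odot>\<^bsub>M\<^esub> h n \<oplus>\<^bsub>M\<^esub> (\<Oplus>\<^bsub>M\<^esub>k\<in>{..<n}. F j k \<odot>\<^bsub>M\<^esub> h k)"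
    and cl: "(\<Oplus>\<^bsub>M\<^esub>k\<in>{..<n}. F j k \<odot>\<^bsub>M\<^esub> h k) \<in> carrier M" if "j \<le> n" for j
    using Suc.prems that by (auto simp: lessThan_Suc Pi_def intro!: M.finsum_closed)
  have IH: "\<forall>j<n. h j \<in> N'"
  proof (rule Suc.IH[OF sub])
    fix j assume j: "j < n"
    have "F j n \<odot>\<^bsub>M\<^esub> h n \<oplus>\<^bsub>M\<^esub> (\<Oplus>\<^bsub>M\<^esub>k\<in>{..<n}. F j k \<odot>\<^bsub>M\<^esub> h k) \<in> N'"
      using Suc.prems(6)[of j] j split NN' by simp
    moreover have Fh: "F j n \<odot>\<^bsub>M\<^esub> h n \<in> N'" using j Suc.prems(5) mN' by simp
    ultimately have "\<ominus>\<^bsub>M\<^esub> (F j n \<odot>\<^bsub>M\<^esub> h n) \<oplus>\<^bsub>M\<^esub> (F j n \<odot>\<^bsub>M\<^esub> h n \<oplus>\<^bsub>M\<^esub> (\<Oplus>\<^bsub>M\<^esub>k\<in>{..<n}. F j k \<odot>\<^bsub>M\<^esub> h k)) \<in> N'"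
      using N'(3,5) by blast
    then show "(\<Oplus>\<^bsub>M\<^esub>k\<in>{..<n}. F j k \<odot>\<^bsub>M\<^esub> h k) \<in> N'"
      using Fh N'(1) cl[of j] j by (simp add: M.r_neg1 subsetD)
  qed (use Suc.prems in auto)
  have "(\<Oplus>\<^bsub>M\<^esub>k\<in>{..<n}. F n k \<odot>\<^bsub>M\<^esub> h k) \<in> N'"
    using IH Suc.prems(3) N'(4) by (intro submodule_finsum_closed[OF sub]) auto
  moreover have "F n n \<odot>\<^bsub>M\<^esub> h n \<oplus>\<^bsub>M\<^esub> (\<Oplus>\<^bsub>M\<^esub>k\<in>{..<n}. F n k \<odot>\<^bsub>M\<^esub> h k) \<in> N'"
    using Suc.prems(6)[of n] split NN' by simp
  ultimately have "(F n n \<odot>\<^bsub>M\<^esub> h n \<oplus>\<^bsub>M\<^esub> (\<Oplus>\<^bsub>M\<^esub>k\<in>{..<n}. F n k \<odot>\<^bsub>M\<^esub> h k)) \<oplus>\<^bsub>M\<^esub> \<ominus>\<^bsub>M\<^esub> (\<Oplus>\<^bsub>M\<^esub>k\<in>{..<n}. F n k \<odot>\<^bsub>M\<^esub> h k) \<in> N'"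
    using N'(3,5) by blast
  then have "F n n \<odot>\<^bsub>M\<^esub> h n \<in> N'"
    using cl[of n] hn Suc.prems(3) by (simp add: M.a_assoc M.r_neg)
  then obtain \<nu> s where \<nu>: "\<nu> \<in> N" "s \<in> m" "F n n \<odot>\<^bsub>M\<^esub> h n = \<nu> \<oplus>\<^bsub>M\<^esub> s \<odot>\<^bsub>M\<^esub> h n"
    unfolding N'_def by blast
  define w where "w = F n n \<ominus> s"
  have w: "w \<in> Units R" unfolding w_def using Suc.prems(4) \<nu>(2) by (intro Units_minus) auto
  have "w \<odot>\<^bsub>M\<^esub> h n = \<nu>"
    using \<nu> hn N(1) Suc.prems(3)[of n n]
    by (simp add: w_def a_minus_def[of R] smult_l_distr smult_l_minus M.a_assoc M.r_neg subsetD)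
  then have "inv w \<odot>\<^bsub>M\<^esub> (w \<odot>\<^bsub>M\<^esub> h n) \<in> N" using \<nu>(1) w N(4) by simp
  then have hnN: "h n \<in> N" using w hn by (simp add: smult_assoc1[symmetric] Units_closed)
  \<comment> \<open>Once h_n is in N, the enlargement by m h_n was none at all, so the earlier h_j
    are in N too.\<close>
  have "N' \<subseteq> N"
    unfolding N'_def using hnN N(4,5) by auto
  with IH hnN show ?case by (auto simp: less_Suc_eq)
qed

end

section \<open>Exact zerodivisors in a local ring\<close>

lemma (in ring) submodule_ring_mod_ideal:
  assumes "module R (ring_mod R)" "ideal I R"
  shows "submodule I R (ring_mod R)"
proof -
  interpret I: ideal I R by fact
  interpret M: module R "ring_mod R" by fact
  have "\<ominus>\<^bsub>ring_mod R\<^esub> a = \<ominus> a" if "a \<in> carrier R" for a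
    using that M.M.minus_equality[of "\<ominus> a" a] by (simp add: l_neg)
  then show ?thesis
    by (intro M.submoduleI) (auto simp: I.Icarr I.I_l_closed)
qed

lemma (in cring) genideal_sing: "x \<in> carrier R \<Longrightarrow> Idl {x} = {c \<otimes> x | c. c \<in> carrier R}"
  using cgenideal_eq_genideal[of x] by (simp add: cgenideal_def)

lemma (in cring) mem_genideal_sing: "x \<in> carrier R \<Longrightarrow> r \<in> Idl {x} \<longleftrightarrow> (\<exists>c\<in>carrier R. r = c \<otimes> x)"
  unfolding genideal_sing by blast

lemma (in ring) carrier_Quot: "carrier (R Quot I) = (\<lambda>r. I +> r) ` carrier R"
  unfolding FactRing_def A_RCOSETS_def' by auto

lemma zero_Quot: "\<zero>\<^bsub>R Quot I\<^esub> = I"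
  by (simp add: FactRing_def)

lemma (in ring) rcos_eq_ideal_iff:
  assumes "ideal I R" "r \<in> carrier R"
  shows "I +> r = I \<longleftrightarrow> r \<in> I"
proof -
  interpret ideal I R by fact
  show ?thesis using assms(2) rcos_const_imp_mem a_rcos_const by blast
qed

locale exact_zd = local_cring +
  fixes x y
  assumes x_m: "x \<in> m" and y_m: "y \<in> m"
    and ann_x: "r \<in> carrier R \<Longrightarrow> r \<otimes> x = \<zero> \<longleftrightarrow> (\<exists>c\<in>carrier R. r = c \<otimes> y)"
    and ann_y: "r \<in> carrier R \<Longrightarrow> r \<otimes> y = \<zero> \<longleftrightarrow> (\<exists>c\<in>carrier R. r = c \<otimes> x)"
begin

lemma xy_carr [simp, intro]: "x \<in> carrier R" "y \<in> carrier R"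
  using x_m y_m by auto

lemma one_notin_m: "\<one> \<notin> m"
  using Units_iff[of \<one>] by simp

text \<open>If x were 0, then 1 would annihilate it and so lie in (y), inside m; the same holds with
  x and y exchanged.\<close>

lemma nonzero: "x \<noteq> \<zero>" "y \<noteq> \<zero>"
proof -
  have "\<one> \<noteq> c \<otimes> x" "\<one> \<noteq> c \<otimes> y" if "c \<in> carrier R" for c
    using that one_notin_m x_m y_m m.I_l_closed by metis+
  then show "x \<noteq> \<zero>" "y \<noteq> \<zero>" using ann_x[of \<one>] ann_y[of \<one>] by auto
qed

text \<open>Nakayama's lemma for a principal ideal: 1 - s is a unit and kills r.\<close>

lemma eq_smult_self_imp_zero:
  assumes "s \<in> m" "r \<in> carrier R" "r = s \<otimes> r"
  shows "r = \<zero>"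
proof -
  have u: "\<one> \<ominus> s \<in> Units R" using assms by (intro Units_minus) auto
  have s: "s \<in> carrier R" using assms by auto
  have "(\<one> \<ominus> s) \<otimes> r = r \<ominus> s \<otimes> r" using s assms(2) by algebra
  also have "\<dots> = \<zero>" using assms(2) by (simp add: assms(3)[symmetric] minus_eq r_neg)
  finally have "inv (\<one> \<ominus> s) \<otimes> ((\<one> \<ominus> s) \<otimes> r) = \<zero>" using u by simp
  then show ?thesis using u s assms(2) by (simp add: m_assoc[symmetric] Units_closed)
qed

lemma Idl_x: "ideal (Idl {x}) R" and Idl_y: "ideal (Idl {y}) R" and Idl_xy: "ideal (Idl {x, y}) R"
  by (auto intro!: genideal_ideal)

lemma x_in_Idl_xy: "c \<in> carrier R \<Longrightarrow> c \<otimes> x \<in> Idl {x, y}"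
  and y_in_Idl_xy: "c \<in> carrier R \<Longrightarrow> c \<otimes> y \<in> Idl {x, y}"
  using genideal_self[of "{x, y}"] ideal.I_l_closed[OF Idl_xy] by auto

text \<open>The images of z and q in R/(x) form an exact pair, and G-regularity makes one of them
  zero.\<close>

lemma G_regular_quot_no_factorization:
  assumes G: "G_regular (R Quot Idl {x})"
    and z: "z \<in> m" and q: "q \<in> m" and d: "d \<in> carrier R"
    and xqz: "x = q \<otimes> z" and ydz: "y = d \<otimes> z"
  shows False
proof -
  let ?X = "Idl {x}"
  let ?A = "R Quot ?X"
  interpret X: ideal ?X R by (rule Idl_x)
  interpret h: ring_hom_cring R ?A "(+>) ?X" by (rule X.rcos_ring_hom_cring[OF is_cring])
  have zc: "z \<in> carrier R" and qc: "q \<in> carrier R" using z q by auto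
  have zero_iff: "?X +> r = \<zero>\<^bsub>?A\<^esub> \<longleftrightarrow> (\<exists>c\<in>carrier R. r = c \<otimes> x)" if "r \<in> carrier R" for r
  proof -
    have "?X +> r = \<zero>\<^bsub>?A\<^esub> \<longleftrightarrow> r \<in> ?X"
      using rcos_eq_ideal_iff[OF Idl_x that] by (simp only: zero_Quot)
    also have "\<dots> \<longleftrightarrow> (\<exists>c\<in>carrier R. r = c \<otimes> x)"
      unfolding genideal_sing[OF xy_carr(1)] by blast
    finally show ?thesis .
  qed
  have surj: "\<exists>r\<in>carrier R. C = ?X +> r" if "C \<in> carrier ?A" for C
    using that unfolding carrier_Quot by blast
  interpret E: exact_pair ?A "?X +> z" "?X +> q"
  proof (unfold_locales)
    fix C assume "C \<in> carrier ?A"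
    then obtain r where r: "r \<in> carrier R" "C = ?X +> r" using surj by blast
    show "C \<otimes>\<^bsub>?A\<^esub> (?X +> z) = \<zero>\<^bsub>?A\<^esub> \<longleftrightarrow> (\<exists>D\<in>carrier ?A. C = (?X +> q) \<otimes>\<^bsub>?A\<^esub> D)"
    proof
      assume "C \<otimes>\<^bsub>?A\<^esub> (?X +> z) = \<zero>\<^bsub>?A\<^esub>"
      then have "?X +> (r \<otimes> z) = \<zero>\<^bsub>?A\<^esub>" using r zc by simp
      then obtain c where c: "c \<in> carrier R" "r \<otimes> z = c \<otimes> x" using zero_iff[of "r \<otimes> z"] r zc by blast
      then have rz: "r \<otimes> z = c \<otimes> (q \<otimes> z)" by (simp add: xqz)
      \<comment> \<open>Here r - c q kills z. Multiplying by d turns z into y, whose annihilator (x)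
        is known and contained in (q).\<close>
      have "(r \<ominus> c \<otimes> q) \<otimes> y = d \<otimes> (r \<otimes> z \<ominus> c \<otimes> (q \<otimes> z))"
        unfolding ydz using c(1) r(1) zc qc d by algebra
      also have "\<dots> = \<zero>" using c r zc qc d rz by (simp add: minus_eq r_neg)
      finally obtain e where e: "e \<in> carrier R" "r \<ominus> c \<otimes> q = e \<otimes> x"
        using ann_y[of "r \<ominus> c \<otimes> q"] c r qc by auto
      have "r = (r \<ominus> c \<otimes> q) \<oplus> c \<otimes> q" using r c qc by algebra
      also have "\<dots> = q \<otimes> (c \<oplus> e \<otimes> z)" unfolding e(2) xqz using e(1) c(1) qc zc by algebra
      finally have "C = (?X +> q) \<otimes>\<^bsub>?A\<^esub> (?X +> (c \<oplus> e \<otimes> z))"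
        using r qc e(1) c(1) zc by (metis h.hom_mult a_closed m_closed)
      then show "\<exists>D\<in>carrier ?A. C = (?X +> q) \<otimes>\<^bsub>?A\<^esub> D" using e(1) c(1) zc by blast
    next
      assume "\<exists>D\<in>carrier ?A. C = (?X +> q) \<otimes>\<^bsub>?A\<^esub> D"
      then obtain c where c: "c \<in> carrier R" "C = (?X +> q) \<otimes>\<^bsub>?A\<^esub> (?X +> c)" using surj by blast
      then have "C \<otimes>\<^bsub>?A\<^esub> (?X +> z) = ?X +> (q \<otimes> c \<otimes> z)" using qc zc by simp
      also have "\<dots> = \<zero>\<^bsub>?A\<^esub>" using c qc zc by (subst zero_iff) (auto simp: xqz m_ac intro!: bexI[of _ c])
      finally show "C \<otimes>\<^bsub>?A\<^esub> (?X +> z) = \<zero>\<^bsub>?A\<^esub>" .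
    qed
    show "C \<otimes>\<^bsub>?A\<^esub> (?X +> q) = \<zero>\<^bsub>?A\<^esub> \<longleftrightarrow> (\<exists>D\<in>carrier ?A. C = (?X +> z) \<otimes>\<^bsub>?A\<^esub> D)"
    proof
      assume "C \<otimes>\<^bsub>?A\<^esub> (?X +> q) = \<zero>\<^bsub>?A\<^esub>"
      then have "?X +> (r \<otimes> q) = \<zero>\<^bsub>?A\<^esub>" using r qc by simp
      then obtain c where c: "c \<in> carrier R" "r \<otimes> q = c \<otimes> x" using zero_iff[of "r \<otimes> q"] r qc by blast
      then have rz: "r \<otimes> q = c \<otimes> (q \<otimes> z)" by (simp add: xqz)
      \<comment> \<open>Here r - c z kills q. Multiplying by z turns q into x, whose annihilator (y)
        is contained in (z).\<close>
      have "(r \<ominus> c \<otimes> z) \<otimes> x = z \<otimes> (r \<otimes> q \<ominus> c \<otimes> (q \<otimes> z))"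
        unfolding xqz using c(1) r(1) zc qc by algebra
      also have "\<dots> = \<zero>" using c r zc qc rz by (simp add: minus_eq r_neg)
      finally obtain e where e: "e \<in> carrier R" "r \<ominus> c \<otimes> z = e \<otimes> y"
        using ann_x[of "r \<ominus> c \<otimes> z"] c r zc by auto
      have "r = (r \<ominus> c \<otimes> z) \<oplus> c \<otimes> z" using r c zc by algebra
      also have "\<dots> = z \<otimes> (c \<oplus> e \<otimes> d)" unfolding e(2) ydz using e(1) c(1) d zc by algebra
      finally have "C = (?X +> z) \<otimes>\<^bsub>?A\<^esub> (?X +> (c \<oplus> e \<otimes> d))"
        using r d e(1) c(1) zc by (metis h.hom_mult a_closed m_closed)
      then show "\<exists>D\<in>carrier ?A. C = (?X +> z) \<otimes>\<^bsub>?A\<^esub> D" using e(1) c(1) d by blast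
    next
      assume "\<exists>D\<in>carrier ?A. C = (?X +> z) \<otimes>\<^bsub>?A\<^esub> D"
      then obtain c where c: "c \<in> carrier R" "C = (?X +> z) \<otimes>\<^bsub>?A\<^esub> (?X +> c)" using surj by blast
      then have "C \<otimes>\<^bsub>?A\<^esub> (?X +> q) = ?X +> (z \<otimes> c \<otimes> q)" using qc zc by simp
      also have "\<dots> = \<zero>\<^bsub>?A\<^esub>" using c qc zc by (subst zero_iff) (auto simp: xqz m_ac intro!: bexI[of _ c])
      finally show "C \<otimes>\<^bsub>?A\<^esub> (?X +> q) = \<zero>\<^bsub>?A\<^esub>" .
    qed
  qed (use zc qc in auto)
  have "?X +> z = \<zero>\<^bsub>?A\<^esub> \<or> ?X +> q = \<zero>\<^bsub>?A\<^esub>"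
    by (rule E.G_regular_imp_trivial[OF G])
  \<comment> \<open>If z lies in (x) = (q z), then z is a multiple of itself by an element of m,
    hence 0; likewise for q.\<close>
  then have "z = \<zero> \<or> q = \<zero>"
  proof
    assume "?X +> z = \<zero>\<^bsub>?A\<^esub>"
    then obtain c where "c \<in> carrier R" "z = (c \<otimes> q) \<otimes> z" using zero_iff zc qc xqz by (auto simp: m_assoc)
    then show ?thesis using eq_smult_self_imp_zero[of "c \<otimes> q" z] q zc m.I_l_closed by auto
  next
    assume "?X +> q = \<zero>\<^bsub>?A\<^esub>"
    then obtain c where "c \<in> carrier R" "q = (c \<otimes> z) \<otimes> q" using zero_iff zc qc xqz by (auto simp: m_ac)
    then show ?thesis using eq_smult_self_imp_zero[of "c \<otimes> z" q] z qc m.I_l_closed by auto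
  qed
  then show False using nonzero xqz zc qc by auto
qed

text \<open>By Nakayama's lemma, this says that the images of the z_j in R/(x,y) minimally generate
  the ideal they span. Some z_j may be a unit.\<close>

definition indep_mod_xy :: "nat \<Rightarrow> (nat \<Rightarrow> 'a) \<Rightarrow> bool" where
  "indep_mod_xy n z \<longleftrightarrow> (\<forall>j<n. z j \<in> carrier R) \<and>
    (\<forall>a. (\<forall>j<n. a j \<in> carrier R) \<longrightarrow> (\<Oplus>j\<in>{..<n}. a j \<otimes> z j) \<in> Idl {x, y} \<longrightarrow> (\<forall>j<n. a j \<in> m))"

lemma indep_mod_xyD:
  assumes "indep_mod_xy n z" "\<And>j. j < n \<Longrightarrow> a j \<in> carrier R" "(\<Oplus>j\<in>{..<n}. a j \<otimes> z j) \<in> Idl {x, y}" "j < n"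
  shows "a j \<in> m"
  using assms unfolding indep_mod_xy_def by blast

text \<open>Otherwise the relation with coefficients 1 at i, -s at k and 0 elsewhere would have a
  unit coefficient. This is what forces n = 1, both when some z_k is a unit and when x is a multiple
  of some z_k.\<close>

lemma indep_mod_xy_two:
  assumes ind: "indep_mod_xy n z" and "i < n" "k < n" "i \<noteq> k" "s \<in> carrier R"
  shows "z i \<ominus> s \<otimes> z k \<notin> Idl {x, y}"
proof
  assume *: "z i \<ominus> s \<otimes> z k \<in> Idl {x, y}"
  interpret RM: module R "ring_mod R" by (rule module_ring_mod)
  let ?c = "\<lambda>l. if k = l then s else \<zero>"
  let ?a = "\<lambda>l. (if l = i then \<one> else \<zero>) \<ominus> ?c l"
  have z: "z l \<in> carrier R" if "l < n" for l using ind that by (simp add: indep_mod_xy_def)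
  have "(\<Oplus>l\<in>{..<n}. ?c l \<otimes> z l) = (\<Oplus>l\<in>{..<n}. if k = l then s \<otimes> z l else \<zero>)"
    using z assms by (intro finsum_cong') auto
  also have "\<dots> = s \<otimes> z k" using z assms by (intro finsum_singleton) auto
  finally have sk: "(\<Oplus>l\<in>{..<n}. ?c l \<otimes> z l) = s \<otimes> z k" .
  have "(\<Oplus>l\<in>{..<n}. ?a l \<otimes> z l) = z i \<ominus> s \<otimes> z k"
    using RM.finsum_delta_minus[of i n \<one> ?c z] assms z sk by (simp add: finsum_ring_mod minus_ring_mod)
  then have "?a i \<in> m" using * assms by (intro indep_mod_xyD[OF ind]) auto
  then show False using \<open>i \<noteq> k\<close> one_notin_m by (simp add: minus_eq)
qed

text \<open>The hypotheses collect what a decomposition of M would provide if the entry of E at g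
  differed from \<beta> by a unit.\<close>

lemma no_mixing:
  assumes G: "G_regular (R Quot Idl {x})" and ind: "indep_mod_xy n z"
    and z: "\<And>j. j < n \<Longrightarrow> z j \<in> m"
    and d: "\<And>j. j < n \<Longrightarrow> d j \<in> carrier R" and b: "\<And>j. j < n \<Longrightarrow> b j \<in> carrier R"
    and t: "\<And>j k. j < n \<Longrightarrow> k < n \<Longrightarrow> t j k \<in> carrier R"
    and y: "y = (\<Oplus>j\<in>{..<n}. z j \<otimes> d j)"
    and xd: "\<And>j. j < n \<Longrightarrow> x \<otimes> d j = b j \<otimes> y"
    and bz: "\<And>j k. j < n \<Longrightarrow> k < n \<Longrightarrow> b j \<otimes> z k = t j k \<otimes> x"
  shows False
proof (cases "\<forall>j<n. \<forall>k<n. t j k \<in> m")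
  case True
  interpret RM: module R "ring_mod R" by (rule module_ring_mod)
  have zc: "z j \<in> carrier R" if "j < n" for j using z[OF that] by auto
  \<comment> \<open>Expanding y in x d_j = b_j y and using b_j z_k = t_jk x shows that x kills d_j -
    sum t_jk d_k. So the rows of 1 - t send the d_k into the annihilator (y) of x, and 1 - t is the
    identity modulo m.\<close>
  let ?F = "\<lambda>j k. (if k = j then \<one> else \<zero>) \<ominus> t j k"
  have "\<forall>j<n. d j \<in> Idl {y}"
  proof (rule nakayama_triangular[OF module_ring_mod submodule_ring_mod_ideal[OF module_ring_mod Idl_y]])
    fix j assume j: "j < n"
    let ?S = "\<Oplus>k\<in>{..<n}. t j k \<otimes> d k"
    have S: "?S \<in> carrier R" using t d j by (intro finsum_closed) auto
    have "b j \<otimes> y = (\<Oplus>k\<in>{..<n}. b j \<otimes> (z k \<otimes> d k))"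
      unfolding y using b j zc d by (intro finsum_rdistr) auto
    also have "\<dots> = (\<Oplus>k\<in>{..<n}. (t j k \<otimes> d k) \<otimes> x)"
    proof (rule finsum_cong')
      fix k assume "k \<in> {..<n}"
      then have k: "k < n" by simp
      have "b j \<otimes> (z k \<otimes> d k) = (b j \<otimes> z k) \<otimes> d k" using k b j zc d by (simp add: m_assoc)
      then show "b j \<otimes> (z k \<otimes> d k) = (t j k \<otimes> d k) \<otimes> x"
        using bz[OF j k] k t j d by (simp add: m_ac)
    qed (use t d j in auto)
    also have "\<dots> = ?S \<otimes> x" using t d j by (intro finsum_ldistr[symmetric]) auto
    finally have "(d j \<ominus> ?S) \<otimes> x = \<zero>"
      using xd[OF j] d[OF j] S by (simp add: minus_eq l_distr l_minus m_comm[of "d j"] r_neg)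
    then have "d j \<ominus> ?S \<in> Idl {y}"
      using ann_x[of "d j \<ominus> ?S"] d[OF j] S genideal_sing[of y] by auto
    then show "(\<Oplus>\<^bsub>ring_mod R\<^esub>k\<in>{..<n}. ?F j k \<odot>\<^bsub>ring_mod R\<^esub> d k) \<in> Idl {y}"
      using RM.finsum_delta_minus[OF j, of \<one> "t j" d] t d j S by (simp add: finsum_ring_mod minus_ring_mod)
  next
    fix j assume "j < n"
    then show "?F j j \<in> Units R" using True by (auto intro!: Units_minus)
  next
    fix j k :: nat assume "j < k" "k < n"
    then have "t j k \<in> m" using True by auto
    then show "?F j k \<in> m" using \<open>j < k\<close> by (auto simp: minus_eq)
  qed (use t d in auto)
  then obtain c where c: "\<And>j. j < n \<Longrightarrow> c j \<in> carrier R" "\<And>j. j < n \<Longrightarrow> d j = c j \<otimes> y"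
    using genideal_sing[of y] by simp metis
  have "y = (\<Oplus>j\<in>{..<n}. (z j \<otimes> c j) \<otimes> y)"
    by (subst y, rule finsum_cong') (use c zc in \<open>auto simp: m_assoc\<close>)
  also have "\<dots> = (\<Oplus>j\<in>{..<n}. z j \<otimes> c j) \<otimes> y"
    using zc c by (intro finsum_ldistr[symmetric]) auto
  finally have "y = (\<Oplus>j\<in>{..<n}. z j \<otimes> c j) \<otimes> y" .
  moreover have "(\<Oplus>j\<in>{..<n}. z j \<otimes> c j) \<in> m"
    using RM.submodule_finsum_closed[OF submodule_ring_mod_ideal[OF module_ring_mod ideal_m], of "{..<n}" "\<lambda>j. z j \<otimes> c j"]
      z c m.I_r_closed by (simp add: finsum_ring_mod)
  ultimately show False using eq_smult_self_imp_zero nonzero by blast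
next
  case False
  then obtain j k where jk: "j < n" "k < n" "t j k \<notin> m" by blast
  define u where "u = inv (t j k)"
  have tu: "t j k \<in> Units R" using jk t Units_iff by blast
  have u: "u \<in> carrier R" "u \<otimes> t j k = \<one>" using tu by (auto simp: u_def)
  have zc: "z j \<in> carrier R" if "j < n" for j using z[OF that] by auto
  have n: "i = k" if i: "i < n" for i
  proof (rule ccontr)
    assume "i \<noteq> k"
    \<comment> \<open>From x = u b_j z_k and b_j z_i = t_ji x one gets z_i x = s z_k x, so z_i - s
      z_k annihilates x and lies in (y).\<close>
    define s where "s = u \<otimes> t j i"
    have s: "s \<in> carrier R" using u t jk i by (simp add: s_def)
    have x_eq: "x = (u \<otimes> b j) \<otimes> z k"
      using bz[OF jk(1,2)] u t[OF jk(1,2)] b jk zc by (metis l_one m_assoc xy_carr(1))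
    have "(z i \<ominus> s \<otimes> z k) \<otimes> x = z k \<otimes> (u \<otimes> (b j \<otimes> z i)) \<ominus> s \<otimes> z k \<otimes> x"
    proof -
      have "z i \<otimes> x = z k \<otimes> (u \<otimes> (b j \<otimes> z i))"
        using x_eq u(1) b[OF jk(1)] zc[OF jk(2)] zc[OF i] by (simp add: m_ac)
      then show ?thesis using zc[OF i] s zc[OF jk(2)] by (simp add: minus_eq l_distr l_minus)
    qed
    also have "\<dots> = \<zero>"
      using bz[OF jk(1) i] u(1) t[OF jk(1) i] zc[OF jk(2)] by (simp add: s_def m_ac minus_eq r_neg)
    finally have "z i \<ominus> s \<otimes> z k \<in> Idl {x, y}"
      using ann_x[of "z i \<ominus> s \<otimes> z k"] zc i jk s y_in_Idl_xy by auto
    then show False using indep_mod_xy_two[OF ind i jk(2) \<open>i \<noteq> k\<close> s] by blast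
  qed
  then have "k = 0" "\<not> 1 < n" using n[of 0] n[of 1] jk by auto
  then have n1: "n = 1" "k = 0" "j = 0" using jk by auto
  define q where "q = u \<otimes> b 0"
  have q: "q \<in> carrier R" using u b jk n1 by (simp add: q_def)
  have "x = q \<otimes> z 0"
    using bz[OF jk(1,2)] u t[OF jk(1,2)] b jk zc n1 unfolding q_def by (metis l_one m_assoc xy_carr(1))
  moreover have "y = d 0 \<otimes> z 0"
    using y d zc n1 jk by (simp add: lessThan_Suc m_comm)
  \<comment> \<open>A unit q would put z_0 into (x), giving a relation with coefficient 1.\<close>
  moreover have "q \<in> m"
  proof (rule ccontr)
    assume "q \<notin> m"
    then have "q \<in> Units R" using q Units_iff by blast
    then have "z 0 = inv q \<otimes> x" "inv q \<in> carrier R"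
      using zc jk n1 q \<open>x = q \<otimes> z 0\<close> by (auto simp: m_assoc[symmetric])
    then have "\<one> \<otimes> z 0 \<in> Idl {x, y}" using x_in_Idl_xy zc jk n1 by simp
    then have "(\<lambda>_. \<one>) (0::nat) \<in> m"
      using zc jk n1 by (intro indep_mod_xyD[OF ind]) (auto simp: lessThan_Suc)
    then show False using one_notin_m by simp
  qed
  ultimately show False
    using G_regular_quot_no_factorization[OF G, of "z 0" q "d 0"] z d jk n1 by auto
qed

end

section \<open>Indecomposability from a presentation\<close>

text \<open>Let p = c g and p' be the components of the generator g. Then c p' = p - c p lies in
  both summands, so both sides vanish. One of c and 1 - c is a unit, hence p' or p is zero, and its
  summand with it.\<close>

lemma (in local_cring) cyclic_indecomposable:
  assumes M: "module R M" and g: "g \<in> carrier M" "g \<noteq> \<zero>\<^bsub>M\<^esub>"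
    and gen: "\<And>u. u \<in> carrier M \<Longrightarrow> \<exists>r\<in>carrier R. u = r \<odot>\<^bsub>M\<^esub> g"
  shows "indecomposable R M"
  unfolding indecomposable_def
proof (intro conjI allI impI)
  interpret M: module R M by (rule M)
  show "carrier M \<noteq> {\<zero>\<^bsub>M\<^esub>}" using g by auto
  fix N1 N2
  assume asm: "submodule N1 R M \<and> submodule N2 R M \<and> N1 \<inter> N2 = {\<zero>\<^bsub>M\<^esub>} \<and>
         {a \<oplus>\<^bsub>M\<^esub> b | a b. a \<in> N1 \<and> b \<in> N2} = carrier M"
  then have N1: "submodule N1 R M" and N2: "submodule N2 R M" and int: "N1 \<inter> N2 = {\<zero>\<^bsub>M\<^esub>}"
    by auto
  note S1 = M.submoduleE[OF N1] note S2 = M.submoduleE[OF N2]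
  obtain p p' where p: "p \<in> N1" "p' \<in> N2" "g = p \<oplus>\<^bsub>M\<^esub> p'"
    using asm g(1) by blast
  then have pc: "p \<in> carrier M" "p' \<in> carrier M" using S1(1) S2(1) by auto
  obtain c where c: "c \<in> carrier R" "p = c \<odot>\<^bsub>M\<^esub> g" using gen pc by blast
  have "c \<odot>\<^bsub>M\<^esub> p' = p \<ominus>\<^bsub>M\<^esub> c \<odot>\<^bsub>M\<^esub> p"
  proof -
    have "p = c \<odot>\<^bsub>M\<^esub> p \<oplus>\<^bsub>M\<^esub> c \<odot>\<^bsub>M\<^esub> p'" using M.smult_r_distr[OF c(1) pc] c(2) p(3) by metis
    also have "\<dots> = c \<odot>\<^bsub>M\<^esub> p' \<oplus>\<^bsub>M\<^esub> c \<odot>\<^bsub>M\<^esub> p" using c(1) pc by (simp add: M.M.a_comm)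
    finally have "p \<ominus>\<^bsub>M\<^esub> c \<odot>\<^bsub>M\<^esub> p = (c \<odot>\<^bsub>M\<^esub> p' \<oplus>\<^bsub>M\<^esub> c \<odot>\<^bsub>M\<^esub> p) \<ominus>\<^bsub>M\<^esub> c \<odot>\<^bsub>M\<^esub> p"
      by (rule arg_cong[where f = "\<lambda>u. u \<ominus>\<^bsub>M\<^esub> c \<odot>\<^bsub>M\<^esub> p"])
    also have "\<dots> = c \<odot>\<^bsub>M\<^esub> p'" using c(1) pc by (simp add: M.M.minus_eq M.M.a_assoc M.M.r_neg)
    finally show ?thesis by simp
  qed
  moreover have "p \<ominus>\<^bsub>M\<^esub> c \<odot>\<^bsub>M\<^esub> p \<in> N1" using p(1) c(1) S1(3,4,5) by (simp add: M.M.minus_eq)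
  moreover have "c \<odot>\<^bsub>M\<^esub> p' \<in> N2" using p(2) c(1) S2(4) by simp
  ultimately have cp': "c \<odot>\<^bsub>M\<^esub> p' = \<zero>\<^bsub>M\<^esub>" and cp: "p \<ominus>\<^bsub>M\<^esub> c \<odot>\<^bsub>M\<^esub> p = \<zero>\<^bsub>M\<^esub>" using int by auto
  have decomp: "\<exists>r\<in>carrier R. u = r \<odot>\<^bsub>M\<^esub> p \<oplus>\<^bsub>M\<^esub> r \<odot>\<^bsub>M\<^esub> p'" if "u \<in> carrier M" for u
    using gen[OF that] p(3) pc by (auto simp: M.smult_r_distr)
  show "N1 = {\<zero>\<^bsub>M\<^esub>} \<or> N2 = {\<zero>\<^bsub>M\<^esub>}"
  proof (cases "c \<in> m")
    case True
    then have w: "\<one> \<ominus> c \<in> Units R" by (intro Units_minus) auto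
    have "(\<one> \<ominus> c) \<odot>\<^bsub>M\<^esub> p = \<zero>\<^bsub>M\<^esub>"
      using cp c(1) pc by (simp add: a_minus_def M.smult_l_distr M.smult_l_minus)
    then have "inv (\<one> \<ominus> c) \<odot>\<^bsub>M\<^esub> ((\<one> \<ominus> c) \<odot>\<^bsub>M\<^esub> p) = \<zero>\<^bsub>M\<^esub>" using w by simp
    then have "p = \<zero>\<^bsub>M\<^esub>" using w pc by (simp add: M.smult_assoc1[symmetric] Units_closed)
    then have "u \<in> N2" if "u \<in> N1" for u
      using that decomp[of u] S1(1) S2(1,4) p(2) pc by auto
    then show ?thesis using int by auto
  next
    case False
    then have w: "c \<in> Units R" using c Units_iff by blast
    have "inv c \<odot>\<^bsub>M\<^esub> (c \<odot>\<^bsub>M\<^esub> p') = \<zero>\<^bsub>M\<^esub>" using w cp' by simp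
    then have "p' = \<zero>\<^bsub>M\<^esub>" using w pc by (simp add: M.smult_assoc1[symmetric] Units_closed)
    then have "u \<in> N1" if "u \<in> N2" for u
      using that decomp[of u] S2(1) S1(1,4) p(1) pc by auto
    then show ?thesis using int by auto
  qed
qed

section \<open>Finite linear combinations and sums of independent submodules\<close>

lemma (in module) finsum_smult_finsum:
  assumes "finite J" "finite K" "\<And>j. j \<in> J \<Longrightarrow> a j \<in> carrier R"
    and "\<And>j k. j \<in> J \<Longrightarrow> k \<in> K \<Longrightarrow> E j k \<in> carrier R" and "\<And>k. k \<in> K \<Longrightarrow> g k \<in> carrier M"
  shows "(\<Oplus>\<^bsub>M\<^esub>j\<in>J. a j \<odot>\<^bsub>M\<^esub> (\<Oplus>\<^bsub>M\<^esub>k\<in>K. E j k \<odot>\<^bsub>M\<^esub> g k))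
    = (\<Oplus>\<^bsub>M\<^esub>k\<in>K. (\<Oplus>j\<in>J. a j \<otimes> E j k) \<odot>\<^bsub>M\<^esub> g k)"
  using assms(1,3,4)
proof (induction J)
  case empty
  have "(\<Oplus>\<^bsub>M\<^esub>k\<in>K. \<zero> \<odot>\<^bsub>M\<^esub> g k) = (\<Oplus>\<^bsub>M\<^esub>k\<in>K. \<zero>\<^bsub>M\<^esub>)"
    using assms(5) by (intro M.finsum_cong') auto
  then show ?case by simp
next
  case (insert j J)
  have "(\<Oplus>\<^bsub>M\<^esub>i\<in>insert j J. a i \<odot>\<^bsub>M\<^esub> (\<Oplus>\<^bsub>M\<^esub>k\<in>K. E i k \<odot>\<^bsub>M\<^esub> g k))
      = a j \<odot>\<^bsub>M\<^esub> (\<Oplus>\<^bsub>M\<^esub>k\<in>K. E j k \<odot>\<^bsub>M\<^esub> g k) \<oplus>\<^bsub>M\<^esub> (\<Oplus>\<^bsub>M\<^esub>i\<in>J. a i \<odot>\<^bsub>M\<^esub> (\<Oplus>\<^bsub>M\<^esub>k\<in>K. E i k \<odot>\<^bsub>M\<^esub> g k))"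
    using insert assms(5) by (intro M.finsum_insert) (auto intro!: M.finsum_closed smult_closed)
  also have "\<dots> = (\<Oplus>\<^bsub>M\<^esub>k\<in>K. a j \<odot>\<^bsub>M\<^esub> (E j k \<odot>\<^bsub>M\<^esub> g k)) \<oplus>\<^bsub>M\<^esub> (\<Oplus>\<^bsub>M\<^esub>k\<in>K. (\<Oplus>i\<in>J. a i \<otimes> E i k) \<odot>\<^bsub>M\<^esub> g k)"
    using insert assms(2,5) by (simp add: finsum_smult_ldistr Pi_def)
  also have "\<dots> = (\<Oplus>\<^bsub>M\<^esub>k\<in>K. a j \<odot>\<^bsub>M\<^esub> (E j k \<odot>\<^bsub>M\<^esub> g k) \<oplus>\<^bsub>M\<^esub> (\<Oplus>i\<in>J. a i \<otimes> E i k) \<odot>\<^bsub>M\<^esub> g k)"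
    using insert assms(5) by (intro M.finsum_addf[symmetric]) (auto intro!: smult_closed R.finsum_closed)
  also have "\<dots> = (\<Oplus>\<^bsub>M\<^esub>k\<in>K. (\<Oplus>i\<in>insert j J. a i \<otimes> E i k) \<odot>\<^bsub>M\<^esub> g k)"
  proof (rule M.finsum_cong')
    fix k assume k: "k \<in> K"
    then have cl: "(\<Oplus>i\<in>J. a i \<otimes> E i k) \<in> carrier R" "a j \<in> carrier R" "E j k \<in> carrier R"
      using insert by (auto intro!: R.finsum_closed)
    have "(\<Oplus>i\<in>insert j J. a i \<otimes> E i k) = a j \<otimes> E j k \<oplus> (\<Oplus>i\<in>J. a i \<otimes> E i k)"
      using insert k by (intro R.finsum_insert) auto
    then show "a j \<odot>\<^bsub>M\<^esub> (E j k \<odot>\<^bsub>M\<^esub> g k) \<oplus>\<^bsub>M\<^esub> (\<Oplus>i\<in>J. a i \<otimes> E i k) \<odot>\<^bsub>M\<^esub> g k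
        = (\<Oplus>i\<in>insert j J. a i \<otimes> E i k) \<odot>\<^bsub>M\<^esub> g k"
      using cl assms(5)[OF k] by (simp add: smult_l_distr smult_assoc1)
  qed (use insert assms(5) in \<open>auto intro!: smult_closed R.finsum_closed\<close>)
  finally show ?case .
qed

lemma (in module) finsum_smult_add:
  assumes "finite K" "\<And>k. k \<in> K \<Longrightarrow> a k \<in> carrier R" "\<And>k. k \<in> K \<Longrightarrow> p k \<in> carrier M"
    "\<And>k. k \<in> K \<Longrightarrow> q k \<in> carrier M"
  shows "(\<Oplus>\<^bsub>M\<^esub>k\<in>K. a k \<odot>\<^bsub>M\<^esub> (p k \<oplus>\<^bsub>M\<^esub> q k)) = (\<Oplus>\<^bsub>M\<^esub>k\<in>K. a k \<odot>\<^bsub>M\<^esub> p k) \<oplus>\<^bsub>M\<^esub> (\<Oplus>\<^bsub>M\<^esub>k\<in>K. a k \<odot>\<^bsub>M\<^esub> q k)"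
proof -
  have "(\<Oplus>\<^bsub>M\<^esub>k\<in>K. a k \<odot>\<^bsub>M\<^esub> (p k \<oplus>\<^bsub>M\<^esub> q k)) = (\<Oplus>\<^bsub>M\<^esub>k\<in>K. a k \<odot>\<^bsub>M\<^esub> p k \<oplus>\<^bsub>M\<^esub> a k \<odot>\<^bsub>M\<^esub> q k)"
    using assms by (intro M.finsum_cong') (auto simp: smult_r_distr)
  also have "\<dots> = (\<Oplus>\<^bsub>M\<^esub>k\<in>K. a k \<odot>\<^bsub>M\<^esub> p k) \<oplus>\<^bsub>M\<^esub> (\<Oplus>\<^bsub>M\<^esub>k\<in>K. a k \<odot>\<^bsub>M\<^esub> q k)"
    using assms by (intro M.finsum_addf) auto
  finally show ?thesis .
qed

lemma (in module) finsum_smult_delta: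
  assumes "finite K" "j \<in> K" "r \<in> carrier R" "\<And>k. k \<in> K \<Longrightarrow> g k \<in> carrier M"
  shows "(\<Oplus>\<^bsub>M\<^esub>k\<in>K. (if j = k then r else \<zero>) \<odot>\<^bsub>M\<^esub> g k) = r \<odot>\<^bsub>M\<^esub> g j"
proof -
  have "(\<Oplus>\<^bsub>M\<^esub>k\<in>K. (if j = k then r else \<zero>) \<odot>\<^bsub>M\<^esub> g k) = (\<Oplus>\<^bsub>M\<^esub>k\<in>K. if j = k then r \<odot>\<^bsub>M\<^esub> g k else \<zero>\<^bsub>M\<^esub>)"
    using assms by (intro M.finsum_cong') auto
  also have "\<dots> = r \<odot>\<^bsub>M\<^esub> g j" using assms by (intro M.finsum_singleton) auto
  finally show ?thesis .
qed

lemma (in module) independent_submodules_add_eq_zero: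
  assumes "submodule N1 R M" "submodule N2 R M" "N1 \<inter> N2 = {\<zero>\<^bsub>M\<^esub>}"
    and u: "u \<in> N1" and v: "v \<in> N2" and "u \<oplus>\<^bsub>M\<^esub> v = \<zero>\<^bsub>M\<^esub>"
  shows "u = \<zero>\<^bsub>M\<^esub>" and "v = \<zero>\<^bsub>M\<^esub>"
proof -
  have c: "u \<in> carrier M" "v \<in> carrier M" using assms submoduleE(1) by blast+
  then have "u = \<ominus>\<^bsub>M\<^esub> v" using assms(6) M.minus_equality by metis
  then have "u \<in> N2" using submoduleE(3)[OF assms(2) v] by simp
  then show "u = \<zero>\<^bsub>M\<^esub>" using u assms(3) by blast
  then show "v = \<zero>\<^bsub>M\<^esub>" using assms(6) c by simp
qed

context cring
begin

lemma minus_minus_cancel: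
  assumes "a \<in> carrier R" "b \<in> carrier R"
  shows "b = a \<ominus> (a \<ominus> b)"
  using assms by algebra

lemma minus_l_distr:
  assumes "a \<in> carrier R" "b \<in> carrier R" "r \<in> carrier R"
  shows "a \<otimes> r \<ominus> b \<otimes> r = (a \<ominus> b) \<otimes> r"
  using assms by algebra

lemma minus_add_cancel:
  assumes "a \<in> carrier R" "b \<in> carrier R" "c \<in> carrier R" "r \<in> carrier R"
  shows "c \<ominus> b = (a \<otimes> r \<ominus> b \<oplus> c) \<oplus> (\<ominus> a) \<otimes> r"
  using assms by algebra

lemma minus_flip:
  assumes "a \<in> carrier R" "b \<in> carrier R"
  shows "\<ominus> (a \<ominus> b) = b \<ominus> a"
  using assms by algebra

end

text \<open>\<open>g n\<close> is the generator lying over R/(y). In \<open>rel\<close>, the witness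
  b counts how often y g_n - sum z_i g_i occurs in a relation, the rest being multiples of the x
  g_i. Each constraint on a decomposition is obtained by projecting a known relation to N1 and
  applying \<open>rel\<close> to the result.\<close>

lemma (in exact_zd) indecomposable_of_presentation:
  assumes G: "G_regular (R Quot Idl {x})" and ind: "indep_mod_xy n z"
    and M: "module R M" and g: "\<And>i. i < Suc n \<Longrightarrow> g i \<in> carrier M"
    and gen: "\<And>u. u \<in> carrier M \<Longrightarrow>
      \<exists>a. (\<forall>i<Suc n. a i \<in> carrier R) \<and> u = (\<Oplus>\<^bsub>M\<^esub>i\<in>{..<Suc n}. a i \<odot>\<^bsub>M\<^esub> g i)"
    and rel: "\<And>a. (\<And>i. i < Suc n \<Longrightarrow> a i \<in> carrier R) \<Longrightarrow>
      (\<Oplus>\<^bsub>M\<^esub>i\<in>{..<Suc n}. a i \<odot>\<^bsub>M\<^esub> g i) = \<zero>\<^bsub>M\<^esub> \<longleftrightarrow>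
      (\<exists>b\<in>carrier R. a n = b \<otimes> y \<and> (\<forall>i<n. a i \<oplus> b \<otimes> z i \<in> Idl {x}))"
  shows "indecomposable R M"
proof -
  interpret M: module R M by (rule M)
  interpret RM: module R "ring_mod R" by (rule module_ring_mod)
  interpret X: ideal "Idl {x}" R by (rule Idl_x)
  interpret J: ideal "Idl {x, y}" R by (rule Idl_xy)
  let ?K = "{..<Suc n}"
  have zc: "z j \<in> carrier R" if "j < n" for j using ind that by (simp add: indep_mod_xy_def)
  have XJ: "r \<in> Idl {x, y}" if "r \<in> Idl {x}" for r
    using that mem_genideal_sing[of x r] x_in_Idl_xy by blast
  have x_X: "c \<otimes> x \<in> Idl {x}" if "c \<in> carrier R" for c using that mem_genideal_sing[of x] by blast
  \<comment> \<open>Otherwise \<open>rel\<close> would make 1 a multiple of y.\<close>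
  have gn: "g n \<noteq> \<zero>\<^bsub>M\<^esub>"
  proof
    assume "g n = \<zero>\<^bsub>M\<^esub>"
    then have "(\<Oplus>\<^bsub>M\<^esub>i\<in>?K. (if n = i then \<one> else \<zero>) \<odot>\<^bsub>M\<^esub> g i) = \<zero>\<^bsub>M\<^esub>"
      using M.finsum_smult_delta[of ?K n \<one> g] g by simp
    then obtain b where "b \<in> carrier R" "\<one> = b \<otimes> y"
      using rel[of "\<lambda>i. if n = i then \<one> else \<zero>"] by auto
    then show False using one_notin_m y_m m.I_l_closed by metis
  qed
  show ?thesis
  proof (cases "\<forall>j<n. z j \<in> m")
    case False
    then obtain k where k: "k < n" "z k \<notin> m" by blast
    then have zu: "z k \<in> Units R" using zc Units_iff by blast
    have "i = k" if "i < n" for i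
    proof (rule ccontr)
      assume "i \<noteq> k"
      have "z i \<ominus> (z i \<otimes> inv (z k)) \<otimes> z k = \<zero>"
        using zu zc that k(1) by (simp add: m_assoc minus_eq r_neg)
      then show False using indep_mod_xy_two[OF ind that k(1) \<open>i \<noteq> k\<close>, of "z i \<otimes> inv (z k)"] zu zc[OF that]
        by simp
    qed
    note only = this
    have "k = 0" "\<not> 1 < n" using only[of 0] only[of 1] k(1) by auto
    then have n: "n = 1" "k = 0" using k(1) by auto
    \<comment> \<open>The relation y g_1 = z_0 g_0 solved for g_0, so that g_1 alone generates M.
      Below it is verified through \<open>rel\<close> with witness -1/z_0.\<close>
    define r where "r = inv (z 0) \<otimes> y"
    have r: "r \<in> carrier R" using zu n by (simp add: r_def)
    have two: "(\<Oplus>\<^bsub>M\<^esub>i\<in>?K. a i \<odot>\<^bsub>M\<^esub> g i) = a 1 \<odot>\<^bsub>M\<^esub> g 1 \<oplus>\<^bsub>M\<^esub> a 0 \<odot>\<^bsub>M\<^esub> g 0"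
      if "a 0 \<in> carrier R" "a 1 \<in> carrier R" for a
      using g that n by (simp add: lessThan_Suc)
    define a where "a = (\<lambda>i::nat. if i = 0 then \<one> else \<ominus> r)"
    have a: "a 0 = \<one>" "a 1 = \<ominus> r" by (simp_all add: a_def)
    have b: "a 1 = (\<ominus> (inv (z 0))) \<otimes> y" "a 0 \<oplus> (\<ominus> (inv (z 0))) \<otimes> z 0 \<in> Idl {x}" "\<ominus> (inv (z 0)) \<in> carrier R"
      using zu n zc k(1) by (simp_all add: a_def r_def l_minus r_neg)
    have "(\<Oplus>\<^bsub>M\<^esub>i\<in>?K. a i \<odot>\<^bsub>M\<^esub> g i) = \<zero>\<^bsub>M\<^esub>"
      using b n r by (subst rel) (auto simp: a_def[abs_def])
    then have "\<ominus>\<^bsub>M\<^esub> (r \<odot>\<^bsub>M\<^esub> g 1) \<oplus>\<^bsub>M\<^esub> g 0 = \<zero>\<^bsub>M\<^esub>"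
      using two[of a] a r g n by (simp add: M.smult_l_minus)
    then have g0: "g 0 = r \<odot>\<^bsub>M\<^esub> g 1"
      using r g n by (metis M.M.minus_equality M.M.minus_minus M.smult_closed M.M.a_inv_closed M.M.a_comm lessI one_less_numeral_iff zero_less_Suc One_nat_def)
    have "\<exists>s\<in>carrier R. u = s \<odot>\<^bsub>M\<^esub> g 1" if u: "u \<in> carrier M" for u
    proof -
      obtain a where a: "a 0 \<in> carrier R" "a 1 \<in> carrier R" "u = (\<Oplus>\<^bsub>M\<^esub>i\<in>?K. a i \<odot>\<^bsub>M\<^esub> g i)"
        using gen[OF u] n by auto
      then have "u = (a 1 \<oplus> a 0 \<otimes> r) \<odot>\<^bsub>M\<^esub> g 1"
        using two[of a] g0 r g n by (simp add: M.smult_l_distr M.smult_assoc1)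
      then show ?thesis using a r by blast
    qed
    then show ?thesis using cyclic_indecomposable[OF M, of "g 1"] g n gn by auto
  next
    case True
    then have zm: "z j \<in> m" if "j < n" for j using that by blast
    show ?thesis
      unfolding indecomposable_def
    proof (intro conjI allI impI)
      show "carrier M \<noteq> {\<zero>\<^bsub>M\<^esub>}" using g[of n] gn by auto
      fix N1 N2
      assume asm: "submodule N1 R M \<and> submodule N2 R M \<and> N1 \<inter> N2 = {\<zero>\<^bsub>M\<^esub>} \<and>
             {a \<oplus>\<^bsub>M\<^esub> b | a b. a \<in> N1 \<and> b \<in> N2} = carrier M"
      then have N1: "submodule N1 R M" and N2: "submodule N2 R M" and int: "N1 \<inter> N2 = {\<zero>\<^bsub>M\<^esub>}"
        by auto
      note S1 = M.submoduleE[OF N1] note S2 = M.submoduleE[OF N2]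
      note ind0 = M.independent_submodules_add_eq_zero[OF N1 N2 int]
      have "\<exists>u v. u \<in> N1 \<and> v \<in> N2 \<and> g i = u \<oplus>\<^bsub>M\<^esub> v" if "i < Suc n" for i
      proof -
        have "g i \<in> {a \<oplus>\<^bsub>M\<^esub> b | a b. a \<in> N1 \<and> b \<in> N2}" using g[OF that] asm by simp
        then show ?thesis by blast
      qed
      then have "\<exists>p p'. \<forall>i<Suc n. p i \<in> N1 \<and> p' i \<in> N2 \<and> g i = p i \<oplus>\<^bsub>M\<^esub> p' i" by metis
      then obtain p p' where p: "\<And>i. i < Suc n \<Longrightarrow> p i \<in> N1" and p': "\<And>i. i < Suc n \<Longrightarrow> p' i \<in> N2"
        and gp: "\<And>i. i < Suc n \<Longrightarrow> g i = p i \<oplus>\<^bsub>M\<^esub> p' i" by blast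
      have pc: "p i \<in> carrier M" "p' i \<in> carrier M" if "i < Suc n" for i
        using p p' that S1(1) S2(1) by blast+
      have sum1: "(\<Oplus>\<^bsub>M\<^esub>i\<in>?K. a i \<odot>\<^bsub>M\<^esub> p i) \<in> N1" and sum2: "(\<Oplus>\<^bsub>M\<^esub>i\<in>?K. a i \<odot>\<^bsub>M\<^esub> p' i) \<in> N2"
        if "\<And>i. i < Suc n \<Longrightarrow> a i \<in> carrier R" for a
        using that p p' S1(4) S2(4)
        by (auto intro!: M.submodule_finsum_closed[OF N1] M.submodule_finsum_closed[OF N2])
      have split: "(\<Oplus>\<^bsub>M\<^esub>i\<in>?K. a i \<odot>\<^bsub>M\<^esub> g i) = (\<Oplus>\<^bsub>M\<^esub>i\<in>?K. a i \<odot>\<^bsub>M\<^esub> p i) \<oplus>\<^bsub>M\<^esub> (\<Oplus>\<^bsub>M\<^esub>i\<in>?K. a i \<odot>\<^bsub>M\<^esub> p' i)"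
        if "\<And>i. i < Suc n \<Longrightarrow> a i \<in> carrier R" for a
      proof -
        have "(\<Oplus>\<^bsub>M\<^esub>i\<in>?K. a i \<odot>\<^bsub>M\<^esub> g i) = (\<Oplus>\<^bsub>M\<^esub>i\<in>?K. a i \<odot>\<^bsub>M\<^esub> (p i \<oplus>\<^bsub>M\<^esub> p' i))"
          using that g gp pc by (intro M.M.finsum_cong') auto
        also have "\<dots> = (\<Oplus>\<^bsub>M\<^esub>i\<in>?K. a i \<odot>\<^bsub>M\<^esub> p i) \<oplus>\<^bsub>M\<^esub> (\<Oplus>\<^bsub>M\<^esub>i\<in>?K. a i \<odot>\<^bsub>M\<^esub> p' i)"
          using that pc by (intro M.finsum_smult_add) auto
        finally show ?thesis .
      qed
      \<comment> \<open>Row j holds some coefficients of the N1-component of g_j; a choice is needed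
        because the g_i satisfy relations.\<close>
      define E where "E j = (SOME a. (\<forall>i<Suc n. a i \<in> carrier R) \<and> p j = (\<Oplus>\<^bsub>M\<^esub>i\<in>?K. a i \<odot>\<^bsub>M\<^esub> g i))" for j
      have E0: "(\<forall>i<Suc n. E j i \<in> carrier R) \<and> p j = (\<Oplus>\<^bsub>M\<^esub>i\<in>?K. E j i \<odot>\<^bsub>M\<^esub> g i)" if "j < Suc n" for j
        unfolding E_def by (rule someI_ex[OF gen[OF pc(1)[OF that]]])
      then have E: "\<And>j i. j < Suc n \<Longrightarrow> i < Suc n \<Longrightarrow> E j i \<in> carrier R"
        and pE: "\<And>j. j < Suc n \<Longrightarrow> p j = (\<Oplus>\<^bsub>M\<^esub>i\<in>?K. E j i \<odot>\<^bsub>M\<^esub> g i)" by blast+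
      \<comment> \<open>Directness of the sum turns x g_j = 0 into x p_j = 0. In the relation this
        gives, the part x E_ji already lies in (x), which leaves b z_i in (x).\<close>
      have xg: "\<exists>b\<in>carrier R. x \<otimes> E j n = b \<otimes> y \<and> (\<forall>i<n. \<exists>t\<in>carrier R. b \<otimes> z i = t \<otimes> x)" if j: "j < n" for j
      proof -
        have "(\<Oplus>\<^bsub>M\<^esub>i\<in>?K. (if j = i then x else \<zero>) \<odot>\<^bsub>M\<^esub> g i) = \<zero>\<^bsub>M\<^esub>"
          using j zc x_X[of \<one>] by (subst rel) (auto intro!: bexI[of _ \<zero>])
        moreover have "(\<Oplus>\<^bsub>M\<^esub>i\<in>?K. (if j = i then x else \<zero>) \<odot>\<^bsub>M\<^esub> g i) = x \<odot>\<^bsub>M\<^esub> g j"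
          using j g by (intro M.finsum_smult_delta) auto
        moreover have "x \<odot>\<^bsub>M\<^esub> g j = x \<odot>\<^bsub>M\<^esub> p j \<oplus>\<^bsub>M\<^esub> x \<odot>\<^bsub>M\<^esub> p' j"
          using gp[of j] j pc[of j] by (simp add: M.smult_r_distr)
        ultimately have "x \<odot>\<^bsub>M\<^esub> p j = \<zero>\<^bsub>M\<^esub>"
          using ind0(1)[of "x \<odot>\<^bsub>M\<^esub> p j" "x \<odot>\<^bsub>M\<^esub> p' j"] S1(4) S2(4) p[of j] p'[of j] j by simp
        moreover have "x \<odot>\<^bsub>M\<^esub> p j = (\<Oplus>\<^bsub>M\<^esub>i\<in>?K. (x \<otimes> E j i) \<odot>\<^bsub>M\<^esub> g i)"
        proof -
          have "x \<odot>\<^bsub>M\<^esub> p j = (\<Oplus>\<^bsub>M\<^esub>i\<in>?K. x \<odot>\<^bsub>M\<^esub> (E j i \<odot>\<^bsub>M\<^esub> g i))"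
            unfolding pE[OF less_SucI[OF j]] using E[of j] g j by (intro M.finsum_smult_ldistr) auto
          also have "\<dots> = (\<Oplus>\<^bsub>M\<^esub>i\<in>?K. (x \<otimes> E j i) \<odot>\<^bsub>M\<^esub> g i)"
            using E[of j] g j by (intro M.M.finsum_cong') (auto simp: M.smult_assoc1)
          finally show ?thesis .
        qed
        ultimately obtain b where b: "b \<in> carrier R" "x \<otimes> E j n = b \<otimes> y"
          "\<And>i. i < n \<Longrightarrow> x \<otimes> E j i \<oplus> b \<otimes> z i \<in> Idl {x}"
          using rel[of "\<lambda>i. x \<otimes> E j i"] E[of j] j by auto
        have "\<exists>t\<in>carrier R. b \<otimes> z i = t \<otimes> x" if i: "i < n" for i
        proof -
          have Eji: "E j i \<in> carrier R" using E i j by simp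
          have "E j i \<otimes> x \<in> Idl {x}" using x_X Eji by blast
          then have "\<ominus> (x \<otimes> E j i) \<oplus> (x \<otimes> E j i \<oplus> b \<otimes> z i) \<in> Idl {x}"
            using b(3)[OF i] Eji by (simp add: m_comm)
          also have "\<ominus> (x \<otimes> E j i) \<oplus> (x \<otimes> E j i \<oplus> b \<otimes> z i) = b \<otimes> z i"
            using Eji b(1) zc[OF i] by (simp add: r_neg1)
          finally show ?thesis using mem_genideal_sing[of x] by blast
        qed
        with b show ?thesis by blast
      qed
      define b where "b j = (SOME b. b \<in> carrier R \<and> x \<otimes> E j n = b \<otimes> y \<and> (\<forall>i<n. \<exists>t\<in>carrier R. b \<otimes> z i = t \<otimes> x))" for j
      have b0: "b j \<in> carrier R \<and> x \<otimes> E j n = b j \<otimes> y \<and> (\<forall>i<n. \<exists>t\<in>carrier R. b j \<otimes> z i = t \<otimes> x)" if "j < n" for j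
      proof -
        have "\<exists>b. b \<in> carrier R \<and> x \<otimes> E j n = b \<otimes> y \<and> (\<forall>i<n. \<exists>t\<in>carrier R. b \<otimes> z i = t \<otimes> x)"
          using xg[OF that] by blast
        then show ?thesis unfolding b_def by (rule someI_ex)
      qed
      then have b: "\<And>j. j < n \<Longrightarrow> b j \<in> carrier R" "\<And>j. j < n \<Longrightarrow> x \<otimes> E j n = b j \<otimes> y"
        by blast+
      define t where "t j i = (SOME t. t \<in> carrier R \<and> b j \<otimes> z i = t \<otimes> x)" for j i
      have t0: "t j i \<in> carrier R \<and> b j \<otimes> z i = t j i \<otimes> x" if "j < n" "i < n" for j i
      proof -
        have "\<exists>t. t \<in> carrier R \<and> b j \<otimes> z i = t \<otimes> x" using b0[OF that(1)] that(2) by blast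
        then show ?thesis unfolding t_def by (rule someI_ex)
      qed
      then have t: "\<And>j i. j < n \<Longrightarrow> i < n \<Longrightarrow> t j i \<in> carrier R"
        "\<And>j i. j < n \<Longrightarrow> i < n \<Longrightarrow> b j \<otimes> z i = t j i \<otimes> x" by blast+
      \<comment> \<open>The coefficients of y g_n - sum z_i g_i; this is a relation by
        \<open>rel\<close> with witness 1, and its N1-component vanishes as well.\<close>
      define a where "a = (\<lambda>i. if i = n then y else \<ominus> z i)"
      have a: "a i \<in> carrier R" if "i < Suc n" for i using that zc by (auto simp: a_def)
      have "(\<Oplus>\<^bsub>M\<^esub>i\<in>?K. a i \<odot>\<^bsub>M\<^esub> g i) = \<zero>\<^bsub>M\<^esub>"
        using a zc by (subst rel) (auto intro!: bexI[of _ \<one>] simp: a_def[abs_def] l_neg)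
      then have "(\<Oplus>\<^bsub>M\<^esub>i\<in>?K. a i \<odot>\<^bsub>M\<^esub> p i) = \<zero>\<^bsub>M\<^esub>"
        using split[OF a] ind0(1)[OF sum1[OF a] sum2[OF a]] by simp
      moreover have "(\<Oplus>\<^bsub>M\<^esub>j\<in>?K. a j \<odot>\<^bsub>M\<^esub> p j) = (\<Oplus>\<^bsub>M\<^esub>j\<in>?K. a j \<odot>\<^bsub>M\<^esub> (\<Oplus>\<^bsub>M\<^esub>i\<in>?K. E j i \<odot>\<^bsub>M\<^esub> g i))"
        using a pE E g by (intro M.M.finsum_cong') (auto intro!: M.smult_closed M.M.finsum_closed)
      moreover have "\<dots> = (\<Oplus>\<^bsub>M\<^esub>i\<in>?K. (\<Oplus>j\<in>?K. a j \<otimes> E j i) \<odot>\<^bsub>M\<^esub> g i)"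
        using a E g by (intro M.finsum_smult_finsum) auto
      ultimately have "(\<Oplus>\<^bsub>M\<^esub>i\<in>?K. (\<Oplus>j\<in>?K. a j \<otimes> E j i) \<odot>\<^bsub>M\<^esub> g i) = \<zero>\<^bsub>M\<^esub>" by simp
      moreover have aE: "(\<Oplus>j\<in>?K. a j \<otimes> E j i) \<in> carrier R" if "i < Suc n" for i
        using that a E by (intro finsum_closed) auto
      \<comment> \<open>Up to multiples of the x g_i, the projected relation is \<beta> times the
        original one.\<close>
      ultimately obtain \<beta> where \<beta>: "\<beta> \<in> carrier R" "(\<Oplus>j\<in>?K. a j \<otimes> E j n) = \<beta> \<otimes> y"
        "\<And>i. i < n \<Longrightarrow> (\<Oplus>j\<in>?K. a j \<otimes> E j i) \<oplus> \<beta> \<otimes> z i \<in> Idl {x}"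
        using rel[of "\<lambda>i. \<Oplus>j\<in>?K. a j \<otimes> E j i"] by auto
      have S: "(\<Oplus>j\<in>{..<n}. E j i \<otimes> z j) \<in> carrier R" if "i < Suc n" for i
        using that E zc by (intro finsum_closed) auto
      have aEsum: "(\<Oplus>j\<in>?K. a j \<otimes> E j i) = E n i \<otimes> y \<ominus> (\<Oplus>j\<in>{..<n}. E j i \<otimes> z j)" if i: "i < Suc n" for i
      proof -
        have "(\<Oplus>j\<in>{..<n}. a j \<otimes> E j i) = (\<Oplus>j\<in>{..<n}. (\<ominus> \<one>) \<otimes> (E j i \<otimes> z j))"
          using i E zc by (intro finsum_cong') (auto simp: a_def l_minus r_minus m_comm)
        also have "\<dots> = (\<ominus> \<one>) \<otimes> (\<Oplus>j\<in>{..<n}. E j i \<otimes> z j)"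
          using i E zc by (intro finsum_rdistr[symmetric]) auto
        finally have "(\<Oplus>j\<in>{..<n}. a j \<otimes> E j i) = \<ominus> (\<Oplus>j\<in>{..<n}. E j i \<otimes> z j)"
          using S[OF i] by (simp add: l_minus)
        moreover have "(\<Oplus>j\<in>?K. a j \<otimes> E j i) = a n \<otimes> E n i \<oplus> (\<Oplus>j\<in>{..<n}. a j \<otimes> E j i)"
          unfolding lessThan_Suc using i E a by (intro finsum_insert) auto
        ultimately show ?thesis using E[of n i] i by (simp add: a_def minus_eq m_comm)
      qed
      have En: "E n i \<in> carrier R" if "i < Suc n" for i using E that by blast
      \<comment> \<open>The coefficient at g_n. It puts the sum of the E_jn z_j into (y), so
        independence yields E_jn in m; the exact equation is kept for the comparison of E_nn with
        \<beta>.\<close>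
      have wy: "(\<Oplus>j\<in>{..<n}. E j n \<otimes> z j) = (E n n \<ominus> \<beta>) \<otimes> y"
      proof -
        have "(\<Oplus>j\<in>{..<n}. E j n \<otimes> z j) = E n n \<otimes> y \<ominus> (E n n \<otimes> y \<ominus> (\<Oplus>j\<in>{..<n}. E j n \<otimes> z j))"
          using S[OF lessI] En[OF lessI] by (intro minus_minus_cancel) auto
        also have "\<dots> = E n n \<otimes> y \<ominus> \<beta> \<otimes> y" using aEsum[of n] \<beta>(2) by simp
        also have "\<dots> = (E n n \<ominus> \<beta>) \<otimes> y" using En[OF lessI] \<beta>(1) by (intro minus_l_distr) auto
        finally show ?thesis .
      qed
      then have Ejn: "E j n \<in> m" if "j < n" for j
        using that E \<beta>(1) y_in_Idl_xy[of "E n n \<ominus> \<beta>"] by (intro indep_mod_xyD[OF ind, where a = "\<lambda>j. E j n"]) auto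
      \<comment> \<open>The coefficient at g_i, read modulo (x,y). The term E_ni y disappears there,
        so nothing is learned about E_ni.\<close>
      have Eji: "(if j = i then \<beta> else \<zero>) \<ominus> E j i \<in> m" if i: "i < n" and j: "j < n" for i j
      proof (rule indep_mod_xyD[OF ind, where a = "\<lambda>j. (if j = i then \<beta> else \<zero>) \<ominus> E j i"])
        have "(\<Oplus>j\<in>{..<n}. ((if j = i then \<beta> else \<zero>) \<ominus> E j i) \<otimes> z j) = \<beta> \<otimes> z i \<ominus> (\<Oplus>j\<in>{..<n}. E j i \<otimes> z j)"
          using RM.finsum_delta_minus[OF i \<beta>(1), of "\<lambda>j. E j i" z] E i zc S[of i] \<beta>(1)
          by (simp add: finsum_ring_mod minus_ring_mod)
        also have "\<dots> = (E n i \<otimes> y \<ominus> (\<Oplus>j\<in>{..<n}. E j i \<otimes> z j) \<oplus> \<beta> \<otimes> z i) \<oplus> (\<ominus> E n i) \<otimes> y"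
          using S[OF less_SucI[OF i]] En[OF less_SucI[OF i]] \<beta>(1) zc[OF i] by (intro minus_add_cancel) auto
        also have "\<dots> \<in> Idl {x, y}"
        proof (rule J.a_closed)
          show "E n i \<otimes> y \<ominus> (\<Oplus>j\<in>{..<n}. E j i \<otimes> z j) \<oplus> \<beta> \<otimes> z i \<in> Idl {x, y}"
            using \<beta>(3)[OF i] aEsum[of i] i XJ by simp
          show "(\<ominus> E n i) \<otimes> y \<in> Idl {x, y}" using En[of i] i by (intro y_in_Idl_xy) auto
        qed
        finally show "(\<Oplus>j\<in>{..<n}. ((if j = i then \<beta> else \<zero>) \<ominus> E j i) \<otimes> z j) \<in> Idl {x, y}" .
      qed (use E i j \<beta>(1) in auto)
      \<comment> \<open>If the difference were a unit w, dividing \<open>wy\<close> by w would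
        express y through the z_j with d_j = E_jn / w. Dividing b_j and t_jk by w as well preserves
        the remaining equations of \<open>no_mixing\<close>.\<close>
      have w: "E n n \<ominus> \<beta> \<in> m"
      proof (rule ccontr)
        define w where "w = E n n \<ominus> \<beta>"
        assume "E n n \<ominus> \<beta> \<notin> m"
        then have wu: "w \<in> Units R" unfolding w_def using En[of n] \<beta>(1) Units_iff by auto
        have iw: "inv w \<in> carrier R" using wu by simp
        have Ec: "E j n \<in> carrier R" if "j < n" for j using E that by simp
        have "y = inv w \<otimes> (w \<otimes> y)" using wu by (simp add: m_assoc[symmetric] Units_closed)
        also have "w \<otimes> y = (\<Oplus>j\<in>{..<n}. E j n \<otimes> z j)" using wy by (simp add: w_def)
        also have "inv w \<otimes> \<dots> = (\<Oplus>j\<in>{..<n}. inv w \<otimes> (E j n \<otimes> z j))"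
          using iw Ec zc by (intro finsum_rdistr) auto
        also have "\<dots> = (\<Oplus>j\<in>{..<n}. z j \<otimes> (inv w \<otimes> E j n))"
          using iw Ec zc by (intro finsum_cong') (auto simp: m_ac)
        finally have y_eq: "y = (\<Oplus>j\<in>{..<n}. z j \<otimes> (inv w \<otimes> E j n))" .
        show False
        proof (rule no_mixing[OF G ind zm _ _ _ y_eq, where b = "\<lambda>j. inv w \<otimes> b j" and t = "\<lambda>j k. inv w \<otimes> t j k"])
          fix j assume j: "j < n"
          show "x \<otimes> (inv w \<otimes> E j n) = inv w \<otimes> b j \<otimes> y"
            using b[OF j] iw Ec[OF j] by (metis m_assoc m_lcomm xy_carr)
          fix k assume k: "k < n"
          show "inv w \<otimes> b j \<otimes> z k = inv w \<otimes> t j k \<otimes> x"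
            using t[OF j k] b(1)[OF j] iw zc[OF k] by (metis m_assoc xy_carr(1))
        qed (use iw Ec b t in auto)
      qed
      \<comment> \<open>Substitute g_i = p_i + p'_i into p_j = sum E_ji g_i and compare components.
        This replaces the missing idempotence: 1 - E annihilates the p_i and E annihilates the
        p'_i.\<close>
      have row: "p j \<ominus>\<^bsub>M\<^esub> (\<Oplus>\<^bsub>M\<^esub>i\<in>?K. E j i \<odot>\<^bsub>M\<^esub> p i) = \<zero>\<^bsub>M\<^esub>" "(\<Oplus>\<^bsub>M\<^esub>i\<in>?K. E j i \<odot>\<^bsub>M\<^esub> p' i) = \<zero>\<^bsub>M\<^esub>" if j: "j < Suc n" for j
      proof -
        let ?s = "\<Oplus>\<^bsub>M\<^esub>i\<in>?K. E j i \<odot>\<^bsub>M\<^esub> p i" and ?s' = "\<Oplus>\<^bsub>M\<^esub>i\<in>?K. E j i \<odot>\<^bsub>M\<^esub> p' i"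
        have s: "?s \<in> N1" "?s' \<in> N2" using sum1[of "E j"] sum2[of "E j"] E j by auto
        then have sc: "?s \<in> carrier M" "?s' \<in> carrier M" using S1(1) S2(1) by auto
        have "p j = ?s \<oplus>\<^bsub>M\<^esub> ?s'" using pE[OF j] split[of "E j"] E[OF j] by simp
        then have "(\<ominus>\<^bsub>M\<^esub> p j \<oplus>\<^bsub>M\<^esub> ?s) \<oplus>\<^bsub>M\<^esub> ?s' = \<ominus>\<^bsub>M\<^esub> p j \<oplus>\<^bsub>M\<^esub> p j"
          using sc pc[OF j] by (simp only: M.M.a_assoc M.M.a_inv_closed)
        then have e: "(\<ominus>\<^bsub>M\<^esub> p j \<oplus>\<^bsub>M\<^esub> ?s) \<oplus>\<^bsub>M\<^esub> ?s' = \<zero>\<^bsub>M\<^esub>" using pc[OF j] by (simp add: M.M.l_neg)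
        have "\<ominus>\<^bsub>M\<^esub> p j \<oplus>\<^bsub>M\<^esub> ?s \<in> N1" using s p[OF j] S1(3,5) by blast
        note z = ind0[OF this s(2) e]
        then show "?s' = \<zero>\<^bsub>M\<^esub>" by blast
        from z(1) have "?s = p j" using sc pc[OF j] by (metis M.M.minus_equality M.M.minus_minus M.M.a_inv_closed M.M.a_comm)
        then show "p j \<ominus>\<^bsub>M\<^esub> ?s = \<zero>\<^bsub>M\<^esub>" using pc[OF j] by (simp add: M.M.minus_eq M.M.r_neg)
      qed
      \<comment> \<open>Since g_n comes last, the uncontrolled entries E_ni lie below the
        diagonal.\<close>
      have upper: "E j k \<in> m" if "j < k" "k < Suc n" for j k
      proof (cases "k = n")
        case True then show ?thesis using that Ejn by simp
      next
        case False
        then have k: "k < n" "j < n" using that by auto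
        then have "\<ominus> (\<zero> \<ominus> E j k) \<in> m" using Eji[OF k] that by auto
        moreover have "\<ominus> (\<zero> \<ominus> E j k) = E j k" using E k by (simp add: minus_eq)
        ultimately show ?thesis by simp
      qed
      have \<beta>E: "\<beta> \<ominus> E j j \<in> m" if "j < Suc n" for j
      proof (cases "j = n")
        case True
        have "\<ominus> (E n n \<ominus> \<beta>) \<in> m" using w by simp
        moreover have "\<ominus> (E n n \<ominus> \<beta>) = \<beta> \<ominus> E n n" using En[OF lessI] \<beta>(1) by (intro minus_flip)
        ultimately show ?thesis using True by simp
      next
        case False then show ?thesis using Eji[of j j] that by simp
      qed
      have Ejj: "E j j = \<beta> \<ominus> (\<beta> \<ominus> E j j)" if "j < Suc n" for j
        using E[OF that that] \<beta>(1) by (intro minus_minus_cancel)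
      have all: "\<exists>a. (\<forall>i<Suc n. a i \<in> carrier R) \<and>
        u = (\<Oplus>\<^bsub>M\<^esub>i\<in>?K. a i \<odot>\<^bsub>M\<^esub> p i) \<oplus>\<^bsub>M\<^esub> (\<Oplus>\<^bsub>M\<^esub>i\<in>?K. a i \<odot>\<^bsub>M\<^esub> p' i)" if "u \<in> carrier M" for u
        using gen[OF that] split by metis
      have zsum: "(\<Oplus>\<^bsub>M\<^esub>i\<in>?K. a i \<odot>\<^bsub>M\<^esub> q i) = \<zero>\<^bsub>M\<^esub>"
        if "\<forall>i<Suc n. a i \<in> carrier R" "\<forall>j<Suc n. q j \<in> {\<zero>\<^bsub>M\<^esub>}" for a q
      proof -
        have "(\<Oplus>\<^bsub>M\<^esub>i\<in>?K. a i \<odot>\<^bsub>M\<^esub> q i) = (\<Oplus>\<^bsub>M\<^esub>i\<in>?K. \<zero>\<^bsub>M\<^esub>)"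
          using that by (intro M.M.finsum_cong') auto
        then show ?thesis by simp
      qed
      show "N1 = {\<zero>\<^bsub>M\<^esub>} \<or> N2 = {\<zero>\<^bsub>M\<^esub>}"
      \<comment> \<open>The diagonal of E is \<beta> modulo m, so exactly one of the two cases below
        makes the relevant diagonal invertible: that of 1 - E if \<beta> is in m, that of E
        otherwise.\<close>
      proof (cases "\<beta> \<in> m")
        case True
        have Em: "E j j \<in> m" if "j < Suc n" for j
        proof -
          have "\<beta> \<oplus> \<ominus> (\<beta> \<ominus> E j j) \<in> m" using True \<beta>E[OF that] by blast
          then show ?thesis using Ejj[OF that] by (simp add: minus_eq)
        qed
        have p0: "\<forall>j<Suc n. p j \<in> {\<zero>\<^bsub>M\<^esub>}"
        proof (rule nakayama_triangular[OF M M.submodule_zero, where F = "\<lambda>j k. (if k = j then \<one> else \<zero>) \<ominus> E j k"])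
          fix j assume j: "j < Suc n"
          show "(if j = j then \<one> else \<zero>) \<ominus> E j j \<in> Units R" using Em[OF j] by (auto intro!: Units_minus)
          show "(\<Oplus>\<^bsub>M\<^esub>k\<in>?K. ((if k = j then \<one> else \<zero>) \<ominus> E j k) \<odot>\<^bsub>M\<^esub> p k) \<in> {\<zero>\<^bsub>M\<^esub>}"
            using M.finsum_delta_minus[OF j one_closed, of "E j" p] E[OF j] pc row(1)[OF j] j by simp
        next
          fix j k :: nat assume jk: "j < k" "k < Suc n"
          show "(if k = j then \<one> else \<zero>) \<ominus> E j k \<in> m" using upper[OF jk] jk by (auto simp: minus_eq)
        qed (use pc E in auto)
        have "u \<in> N2" if u: "u \<in> N1" for u
        proof -
          obtain a where a: "\<forall>i<Suc n. a i \<in> carrier R"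
            "u = (\<Oplus>\<^bsub>M\<^esub>i\<in>?K. a i \<odot>\<^bsub>M\<^esub> p i) \<oplus>\<^bsub>M\<^esub> (\<Oplus>\<^bsub>M\<^esub>i\<in>?K. a i \<odot>\<^bsub>M\<^esub> p' i)"
            using all[of u] u S1(1) by blast
          moreover have "(\<Oplus>\<^bsub>M\<^esub>i\<in>?K. a i \<odot>\<^bsub>M\<^esub> p' i) \<in> N2" using sum2 a(1) by blast
          ultimately show ?thesis using zsum[OF a(1) p0] S2(1) by (simp add: subsetD)
        qed
        then show ?thesis using int by auto
      next
        case False
        then have \<beta>u: "\<beta> \<in> Units R" using \<beta>(1) Units_iff by blast
        have p0: "\<forall>j<Suc n. p' j \<in> {\<zero>\<^bsub>M\<^esub>}"
        proof (rule nakayama_triangular[OF M M.submodule_zero, where F = E])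
          fix j assume j: "j < Suc n"
          show "E j j \<in> Units R" using Units_minus[OF \<beta>u \<beta>E[OF j]] Ejj[OF j] by simp
          show "(\<Oplus>\<^bsub>M\<^esub>k\<in>?K. E j k \<odot>\<^bsub>M\<^esub> p' k) \<in> {\<zero>\<^bsub>M\<^esub>}" using row(2)[OF j] by simp
        qed (use pc E upper in auto)
        have "u \<in> N1" if u: "u \<in> N2" for u
        proof -
          obtain a where a: "\<forall>i<Suc n. a i \<in> carrier R"
            "u = (\<Oplus>\<^bsub>M\<^esub>i\<in>?K. a i \<odot>\<^bsub>M\<^esub> p i) \<oplus>\<^bsub>M\<^esub> (\<Oplus>\<^bsub>M\<^esub>i\<in>?K. a i \<odot>\<^bsub>M\<^esub> p' i)"
            using all[of u] u S2(1) by blast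
          moreover have "(\<Oplus>\<^bsub>M\<^esub>i\<in>?K. a i \<odot>\<^bsub>M\<^esub> p i) \<in> N1" using sum1 a(1) by blast
          ultimately show ?thesis using zsum[OF a(1) p0] S1(1) by (simp add: subsetD)
        qed
        then show ?thesis using int by auto
      qed
    qed
  qed
qed

section \<open>The extension\<close>

text \<open>Scalar multiplication takes a union over the whole coset to avoid choosing a
  representative; \<open>coset_smult\<close> shows that all the united cosets coincide. For a module
  of sequences the cosets have the type \<open>(nat \<Rightarrow> 'a) set\<close>, in which M is
  sought.\<close>

definition quot_module :: "('a, 'm) module \<Rightarrow> 'm set \<Rightarrow> ('a, 'm set) module" where
  "quot_module V W = \<lparr>partial_object.carrier = (\<lambda>v. W +>\<^bsub>V\<^esub> v) ` carrier V,
    monoid.mult = (\<lambda>_ _. W), monoid.one = W, ring.zero = W, ring.add = set_add V,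
    module.smult = (\<lambda>r C. \<Union>c\<in>C. W +>\<^bsub>V\<^esub> (r \<odot>\<^bsub>V\<^esub> c))\<rparr>"

section \<open>Cosets of a submodule\<close>

context module
begin

lemma submoduleI':
  assumes "H \<subseteq> carrier M" "\<zero>\<^bsub>M\<^esub> \<in> H"
    and "\<And>u v. u \<in> H \<Longrightarrow> v \<in> H \<Longrightarrow> u \<oplus>\<^bsub>M\<^esub> v \<in> H"
    and "\<And>r u. r \<in> carrier R \<Longrightarrow> u \<in> H \<Longrightarrow> r \<odot>\<^bsub>M\<^esub> u \<in> H"
  shows "submodule H R M"
proof (rule submoduleI)
  fix u assume u: "u \<in> H"
  then have "(\<ominus> \<one>) \<odot>\<^bsub>M\<^esub> u = \<ominus>\<^bsub>M\<^esub> u" using assms(1) by (simp add: smult_l_minus subsetD)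
  then show "\<ominus>\<^bsub>M\<^esub> u \<in> H" using assms(4)[of "\<ominus> \<one>" u] u by simp
qed (use assms in auto)

lemma submodule_imp_abelian_subgroup:
  assumes "submodule W R M"
  shows "abelian_subgroup W M"
  using assms submodule.axioms(1) abelian_subgroupI3 additive_subgroup.intro M.abelian_group_axioms by blast

lemma coset_eq_iff:
  assumes W: "submodule W R M" and u: "u \<in> carrier M" and v: "v \<in> carrier M"
  shows "W +>\<^bsub>M\<^esub> u = W +>\<^bsub>M\<^esub> v \<longleftrightarrow> (\<exists>w\<in>W. u = w \<oplus>\<^bsub>M\<^esub> v)"
proof -
  interpret W: abelian_subgroup W M by (rule submodule_imp_abelian_subgroup[OF W])
  show ?thesis
    using W.a_rcos_self[OF u] W.a_repr_independence'[OF _ v, of u] by (auto simp: a_r_coset_def')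
qed

lemma coset_smult:
  assumes W: "submodule W R M" and r: "r \<in> carrier R" and v: "v \<in> carrier M"
  shows "(\<Union>c\<in>W +>\<^bsub>M\<^esub> v. W +>\<^bsub>M\<^esub> (r \<odot>\<^bsub>M\<^esub> c)) = W +>\<^bsub>M\<^esub> (r \<odot>\<^bsub>M\<^esub> v)"
proof -
  interpret W: abelian_subgroup W M by (rule submodule_imp_abelian_subgroup[OF W])
  have "W +>\<^bsub>M\<^esub> (r \<odot>\<^bsub>M\<^esub> c) = W +>\<^bsub>M\<^esub> (r \<odot>\<^bsub>M\<^esub> v)" if "c \<in> W +>\<^bsub>M\<^esub> v" for c
  proof -
    obtain w where w: "w \<in> W" "c = w \<oplus>\<^bsub>M\<^esub> v" using \<open>c \<in> W +>\<^bsub>M\<^esub> v\<close> by (auto simp: a_r_coset_def')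
    then have "w \<in> carrier M" by auto
    then have "r \<odot>\<^bsub>M\<^esub> c = r \<odot>\<^bsub>M\<^esub> w \<oplus>\<^bsub>M\<^esub> r \<odot>\<^bsub>M\<^esub> v" "c \<in> carrier M"
      using w r v by (auto simp: smult_r_distr)
    then show ?thesis
      using coset_eq_iff[OF W, of "r \<odot>\<^bsub>M\<^esub> c" "r \<odot>\<^bsub>M\<^esub> v"] r v submoduleE(4)[OF W r w(1)] by auto
  qed
  then show ?thesis using W.a_rcos_self[OF v] by blast
qed

end

lemma quot_module_simps:
  fixes V :: "('a, 'm) module"
  assumes V: "module R V" and W: "submodule W R V"
  shows "carrier (quot_module V W) = (\<lambda>v. W +>\<^bsub>V\<^esub> v) ` carrier V"
    and "\<zero>\<^bsub>quot_module V W\<^esub> = W +>\<^bsub>V\<^esub> \<zero>\<^bsub>V\<^esub>"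
    and "u \<in> carrier V \<Longrightarrow> v \<in> carrier V \<Longrightarrow>
      (W +>\<^bsub>V\<^esub> u) \<oplus>\<^bsub>quot_module V W\<^esub> (W +>\<^bsub>V\<^esub> v) = W +>\<^bsub>V\<^esub> (u \<oplus>\<^bsub>V\<^esub> v)"
    and "r \<in> carrier R \<Longrightarrow> v \<in> carrier V \<Longrightarrow>
      r \<odot>\<^bsub>quot_module V W\<^esub> (W +>\<^bsub>V\<^esub> v) = W +>\<^bsub>V\<^esub> (r \<odot>\<^bsub>V\<^esub> v)"
proof -
  interpret V: module R V by (rule V)
  interpret W: abelian_subgroup W V by (rule V.submodule_imp_abelian_subgroup[OF W])
  show "carrier (quot_module V W) = (\<lambda>v. W +>\<^bsub>V\<^esub> v) ` carrier V" by (simp add: quot_module_def)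
  show "\<zero>\<^bsub>quot_module V W\<^esub> = W +>\<^bsub>V\<^esub> \<zero>\<^bsub>V\<^esub>"
    using W.a_subset by (simp add: quot_module_def)
  show "u \<in> carrier V \<Longrightarrow> v \<in> carrier V \<Longrightarrow>
      (W +>\<^bsub>V\<^esub> u) \<oplus>\<^bsub>quot_module V W\<^esub> (W +>\<^bsub>V\<^esub> v) = W +>\<^bsub>V\<^esub> (u \<oplus>\<^bsub>V\<^esub> v)"
    using W.a_rcos_sum by (simp add: quot_module_def)
  show "r \<in> carrier R \<Longrightarrow> v \<in> carrier V \<Longrightarrow>
      r \<odot>\<^bsub>quot_module V W\<^esub> (W +>\<^bsub>V\<^esub> v) = W +>\<^bsub>V\<^esub> (r \<odot>\<^bsub>V\<^esub> v)"
    using V.coset_smult[OF W] by (simp add: quot_module_def)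
qed

lemma module_quot_module:
  fixes V :: "('a, 'm) module"
  assumes V: "module R V" and W: "submodule W R V"
  shows "module R (quot_module V W)"
proof -
  interpret V: module R V by (rule V)
  note q = quot_module_simps[OF V W]
  let ?Q = "quot_module V W"
  have E: "\<exists>v\<in>carrier V. C = W +>\<^bsub>V\<^esub> v" if "C \<in> carrier ?Q" for C using that unfolding q(1) by blast
  show ?thesis
  proof (rule moduleI)
    show "abelian_group ?Q"
    proof (rule abelian_groupI)
      fix C assume "C \<in> carrier ?Q"
      then obtain v where v: "v \<in> carrier V" "C = W +>\<^bsub>V\<^esub> v" using E by blast
      then have "(W +>\<^bsub>V\<^esub> (\<ominus>\<^bsub>V\<^esub> v)) \<oplus>\<^bsub>?Q\<^esub> C = \<zero>\<^bsub>?Q\<^esub>" by (simp add: q(2,3) V.M.l_neg)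
      moreover have "W +>\<^bsub>V\<^esub> (\<ominus>\<^bsub>V\<^esub> v) \<in> carrier ?Q" using v q(1) by simp
      ultimately show "\<exists>D\<in>carrier ?Q. D \<oplus>\<^bsub>?Q\<^esub> C = \<zero>\<^bsub>?Q\<^esub>" by blast
    qed (auto simp: q V.M.a_ac)
  qed (auto simp: q V.is_cring V.smult_l_distr V.smult_r_distr V.smult_assoc1)
qed

lemma module_power_mod:
  fixes M :: "('a, 'm) module"
  assumes "module R M"
  shows "module R (power_mod M n)"
proof -
  interpret module R M by fact
  show ?thesis
proof (rule moduleI)
  show "abelian_group (power_mod M n)"
  proof (rule abelian_groupI)
    fix v assume "v \<in> carrier (power_mod M n)"
    then show "\<exists>w\<in>carrier (power_mod M n). w \<oplus>\<^bsub>power_mod M n\<^esub> v = \<zero>\<^bsub>power_mod M n\<^esub>"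
      by (intro bexI[of _ "\<lambda>i. \<ominus>\<^bsub>M\<^esub> v i"]) (auto simp: power_mod_def M.l_neg)
  qed (auto simp: power_mod_def M.a_ac fun_eq_iff)
qed (auto simp: power_mod_def is_cring smult_l_distr smult_r_distr smult_assoc1 fun_eq_iff)
qed

lemma (in ring) rcos_eq_iff:
  assumes "ideal I R" "a \<in> carrier R" "b \<in> carrier R"
  shows "I +> a = I +> b \<longleftrightarrow> a \<ominus> b \<in> I"
  using quotient_eq_iff_same_a_r_cos[OF assms] by simp

lemma (in ideal) quot_mod_simps:
  "carrier (quot_mod R I) = (\<lambda>r. I +> r) ` carrier R"
  "\<zero>\<^bsub>quot_mod R I\<^esub> = I"
  "a \<in> carrier R \<Longrightarrow> b \<in> carrier R \<Longrightarrow> (I +> a) \<oplus>\<^bsub>quot_mod R I\<^esub> (I +> b) = I +> (a \<oplus> b)"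
  "a \<in> carrier R \<Longrightarrow> b \<in> carrier R \<Longrightarrow> a \<odot>\<^bsub>quot_mod R I\<^esub> (I +> b) = I +> (a \<otimes> b)"
  by (simp add: quot_mod_def carrier_Quot) (simp_all add: quot_mod_def FactRing_def a_rcos_sum rcoset_mult_add)

text \<open>M is R^(n+1) modulo the submodule of relations, f places (R/(x))^n in the first n
  coordinates, and g is the last coordinate modulo y.\<close>

lemma (in exact_zd) extension_exists:
  assumes G: "G_regular (R Quot Idl {x})" and ind: "indep_mod_xy n z"
  shows "\<exists>(M :: ('a, (nat \<Rightarrow> 'a) set) module) f g.
        module R M \<and>
        f \<in> mod_hom R (power_mod (quot_mod R (Idl {x})) n) M \<and>
        inj_on f (carrier (power_mod (quot_mod R (Idl {x})) n)) \<and>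
        g \<in> mod_hom R M (quot_mod R (Idl {y})) \<and>
        g ` carrier M = carrier (quot_mod R (Idl {y})) \<and>
        f ` carrier (power_mod (quot_mod R (Idl {x})) n)
          = {u \<in> carrier M. g u = \<zero>\<^bsub>quot_mod R (Idl {y})\<^esub>} \<and>
        indecomposable R M"
proof -
  let ?X = "Idl {x}" and ?Y = "Idl {y}"
  let ?V = "power_mod (ring_mod R) (Suc n)"
  let ?L = "power_mod (quot_mod R ?X) n"
  interpret X: ideal ?X R by (rule Idl_x)
  interpret Y: ideal ?Y R by (rule Idl_y)
  interpret V: module R ?V by (rule module_power_mod[OF module_ring_mod])
  have zc: "z j \<in> carrier R" if "j < n" for j using ind that by (simp add: indep_mod_xy_def)
  have Xmem: "r \<in> ?X \<longleftrightarrow> (\<exists>c\<in>carrier R. r = c \<otimes> x)" for r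
    using mem_genideal_sing[of x r] by simp
  have Ymem: "r \<in> ?Y \<longleftrightarrow> (\<exists>c\<in>carrier R. r = c \<otimes> y)" for r
    using mem_genideal_sing[of y r] by simp
  have Vc: "v \<in> carrier ?V \<longleftrightarrow> (\<forall>i<Suc n. v i \<in> carrier R) \<and> (\<forall>i\<ge>Suc n. v i = \<zero>)" for v
    by (auto simp: power_mod_def)
  have Vz: "\<zero>\<^bsub>?V\<^esub> = (\<lambda>_. \<zero>)" by (simp add: power_mod_def)
  have Va: "u \<oplus>\<^bsub>?V\<^esub> v = (\<lambda>i. if i < Suc n then u i \<oplus> v i else \<zero>)" for u v
    by (simp add: power_mod_def fun_eq_iff)
  have Vs: "r \<odot>\<^bsub>?V\<^esub> v = (\<lambda>i. if i < Suc n then r \<otimes> v i else \<zero>)" for r v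
    by (simp add: power_mod_def fun_eq_iff)
  define W where "W = {w \<in> carrier ?V. \<exists>b\<in>carrier R. w n = b \<otimes> y \<and> (\<forall>i<n. w i \<oplus> b \<otimes> z i \<in> ?X)}"
  have W: "submodule W R ?V"
  proof (rule V.submoduleI')
    show "W \<subseteq> carrier ?V" by (auto simp: W_def)
    show "\<zero>\<^bsub>?V\<^esub> \<in> W" using zc by (auto simp: W_def Vz Vc intro!: bexI[of _ \<zero>])
  next
    fix u v assume u: "u \<in> W" and v: "v \<in> W"
    then obtain b c where b: "b \<in> carrier R" "u n = b \<otimes> y" "\<And>i. i < n \<Longrightarrow> u i \<oplus> b \<otimes> z i \<in> ?X"
      and c: "c \<in> carrier R" "v n = c \<otimes> y" "\<And>i. i < n \<Longrightarrow> v i \<oplus> c \<otimes> z i \<in> ?X" by (auto simp: W_def)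
    have uv: "u \<in> carrier ?V" "v \<in> carrier ?V" using u v by (auto simp: W_def)
    have "(u i \<oplus> v i) \<oplus> (b \<oplus> c) \<otimes> z i \<in> ?X" if i: "i < n" for i
    proof -
      have "(u i \<oplus> v i) \<oplus> (b \<oplus> c) \<otimes> z i = (u i \<oplus> b \<otimes> z i) \<oplus> (v i \<oplus> c \<otimes> z i)"
        using uv b(1) c(1) zc[OF i] i by (simp add: Vc l_distr a_ac)
      then show ?thesis using b(3)[OF i] c(3)[OF i] by simp
    qed
    then show "u \<oplus>\<^bsub>?V\<^esub> v \<in> W"
      using uv b(1,2) c(1,2) V.M.a_closed[OF uv] unfolding W_def
      by (auto simp: Va l_distr intro!: bexI[of _ "b \<oplus> c"])
  next
    fix r u assume r: "r \<in> carrier R" and u: "u \<in> W"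
    then obtain b where b: "b \<in> carrier R" "u n = b \<otimes> y" "\<And>i. i < n \<Longrightarrow> u i \<oplus> b \<otimes> z i \<in> ?X"
      by (auto simp: W_def)
    have uc: "u \<in> carrier ?V" using u by (auto simp: W_def)
    have "r \<otimes> u i \<oplus> r \<otimes> b \<otimes> z i \<in> ?X" if i: "i < n" for i
    proof -
      have "r \<otimes> u i \<oplus> r \<otimes> b \<otimes> z i = r \<otimes> (u i \<oplus> b \<otimes> z i)"
        using uc b(1) zc[OF i] i r by (simp add: Vc r_distr m_assoc)
      then show ?thesis using X.I_l_closed[OF b(3)[OF i] r] by simp
    qed
    then show "r \<odot>\<^bsub>?V\<^esub> u \<in> W"
      using uc b(1,2) r V.smult_closed[OF r uc] unfolding W_def
      by (auto simp: Vs m_assoc intro!: bexI[of _ "r \<otimes> b"])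
  qed
  define M where "M = quot_module ?V W"
  define \<pi> where "\<pi> v = W +>\<^bsub>?V\<^esub> v" for v
  have M: "module R M" unfolding M_def by (rule module_quot_module[OF V.module_axioms W])
  interpret M: module R M by (rule M)
  note q = quot_module_simps[OF V.module_axioms W, folded M_def \<pi>_def]
  have \<pi>_eq: "\<pi> u = \<pi> v \<longleftrightarrow> (\<exists>w\<in>W. u = w \<oplus>\<^bsub>?V\<^esub> v)" if "u \<in> carrier ?V" "v \<in> carrier ?V" for u v
    using V.coset_eq_iff[OF W that] by (simp add: \<pi>_def)
  have \<pi>_zero: "\<pi> v = \<zero>\<^bsub>M\<^esub> \<longleftrightarrow> v \<in> W" if v: "v \<in> carrier ?V" for v
  proof -
    have "w \<oplus>\<^bsub>?V\<^esub> \<zero>\<^bsub>?V\<^esub> = w" if "w \<in> W" for w using that by (intro V.M.r_zero) (auto simp: W_def)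
    then show ?thesis using \<pi>_eq[OF v V.M.zero_closed] by (auto simp: q(2))
  qed
  have \<pi>_surj: "\<exists>v\<in>carrier ?V. u = \<pi> v" if "u \<in> carrier M" for u using that unfolding q(1) by blast
  have \<pi>_carr: "\<pi> v \<in> carrier M" if "v \<in> carrier ?V" for v using that unfolding q(1) by blast

  define e where "e i = (\<lambda>k::nat. if k = i then \<one> else \<zero>)" for i
  have e: "e i \<in> carrier ?V" if "i < Suc n" for i using that by (auto simp: Vc e_def)
  define g0 where "g0 i = \<pi> (e i)" for i
  have g0: "g0 i \<in> carrier M" if "i < Suc n" for i using e[OF that] \<pi>_carr by (simp add: g0_def)
  have lin: "\<pi> v = (\<Oplus>\<^bsub>M\<^esub>i\<in>{..<Suc n}. v i \<odot>\<^bsub>M\<^esub> g0 i)" if v: "v \<in> carrier ?V" for v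
  proof -
    \<comment> \<open>Truncations of v, so that the expansion in the generators follows by induction
      on the number of coordinates kept.\<close>
    define tr where "tr j = (\<lambda>k. if k < j then v k else \<zero>)" for j
    have tr: "tr j \<in> carrier ?V" if "j \<le> Suc n" for j using v that by (auto simp: Vc tr_def)
    have "\<pi> (tr j) = (\<Oplus>\<^bsub>M\<^esub>i\<in>{..<j}. v i \<odot>\<^bsub>M\<^esub> g0 i)" if "j \<le> Suc n" for j
      using that
    proof (induction j)
      case 0
      have "tr 0 = \<zero>\<^bsub>?V\<^esub>" by (simp add: tr_def Vz)
      then show ?case by (simp add: q(2))
    next
      case (Suc j)
      have vj: "v j \<in> carrier R" using v Suc.prems by (simp add: Vc)
      have "tr (Suc j) = (v j \<odot>\<^bsub>?V\<^esub> e j) \<oplus>\<^bsub>?V\<^esub> tr j"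
        using v Suc.prems by (auto simp: fun_eq_iff tr_def Va Vs e_def Vc less_Suc_eq)
      then have "\<pi> (tr (Suc j)) = v j \<odot>\<^bsub>M\<^esub> g0 j \<oplus>\<^bsub>M\<^esub> \<pi> (tr j)"
        using e[of j] tr[of j] vj Suc.prems by (simp add: q(3,4) g0_def)
      also have "\<pi> (tr j) = (\<Oplus>\<^bsub>M\<^esub>i\<in>{..<j}. v i \<odot>\<^bsub>M\<^esub> g0 i)" using Suc by simp
      also have "v j \<odot>\<^bsub>M\<^esub> g0 j \<oplus>\<^bsub>M\<^esub> \<dots> = (\<Oplus>\<^bsub>M\<^esub>i\<in>{..<Suc j}. v i \<odot>\<^bsub>M\<^esub> g0 i)"
        unfolding lessThan_Suc using v g0 Suc.prems by (intro M.finsum_insert[symmetric]) (auto simp: Vc intro!: M.smult_closed)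
      finally show ?case .
    qed
    moreover have "tr (Suc n) = v" using v by (auto simp: tr_def Vc fun_eq_iff)
    ultimately show ?thesis by (metis order_refl)
  qed
  have indec: "indecomposable R M"
  proof (rule indecomposable_of_presentation[OF G ind M g0])
    fix u assume "u \<in> carrier M"
    then obtain v where "v \<in> carrier ?V" "u = \<pi> v" using \<pi>_surj by blast
    then show "\<exists>a. (\<forall>i<Suc n. a i \<in> carrier R) \<and> u = (\<Oplus>\<^bsub>M\<^esub>i\<in>{..<Suc n}. a i \<odot>\<^bsub>M\<^esub> g0 i)"
      using lin by (auto simp: Vc)
  next
    fix a :: "nat \<Rightarrow> 'a" assume a: "\<And>i. i < Suc n \<Longrightarrow> a i \<in> carrier R"
    define v where "v = (\<lambda>i. if i < Suc n then a i else \<zero>)"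
    have v: "v \<in> carrier ?V" using a by (auto simp: v_def Vc)
    have "(\<Oplus>\<^bsub>M\<^esub>i\<in>{..<Suc n}. a i \<odot>\<^bsub>M\<^esub> g0 i) = (\<Oplus>\<^bsub>M\<^esub>i\<in>{..<Suc n}. v i \<odot>\<^bsub>M\<^esub> g0 i)"
      using a g0 by (intro M.M.finsum_cong') (auto simp: v_def)
    also have "\<dots> = \<pi> v" using lin[OF v] by simp
    finally show "(\<Oplus>\<^bsub>M\<^esub>i\<in>{..<Suc n}. a i \<odot>\<^bsub>M\<^esub> g0 i) = \<zero>\<^bsub>M\<^esub> \<longleftrightarrow>
      (\<exists>b\<in>carrier R. a n = b \<otimes> y \<and> (\<forall>i<n. a i \<oplus> b \<otimes> z i \<in> ?X))"
      using \<pi>_zero[OF v] v by (simp add: W_def v_def)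
  qed

  \<comment> \<open>Lifts of the elements of (R/(x))^n, sitting in R^(n+1) with last coordinate 0;
    \<open>cs\<close> reduces them modulo x.\<close>
  define V0 where "V0 = {r. (\<forall>i<n. r i \<in> carrier R) \<and> (\<forall>i\<ge>n. r i = \<zero>)}"
  define cs where "cs r = (\<lambda>i::nat. ?X +> r i)" for r
  \<comment> \<open>\<open>power_mod\<close> pads with the zero of R/(x), which is the ideal itself.
    By this equation, padding a lift with 0 agrees with that convention.\<close>
  have X0: "?X +> \<zero> = ?X" using X.a_subset by simp
  have V0V: "r \<in> carrier ?V" "r n = \<zero>" if "r \<in> V0" for r
    using that by (auto simp: V0_def Vc less_Suc_eq)
  have L: "carrier ?L = cs ` V0"
  proof (intro equalityI subsetI)
    fix v assume v: "v \<in> carrier ?L"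
    then have "\<exists>s\<in>carrier R. v i = ?X +> s" if "i < n" for i
    proof -
      have "v i \<in> (+>) ?X ` carrier R" using v that by (simp add: power_mod_def X.quot_mod_simps)
      then show ?thesis by blast
    qed
    then have "\<exists>s. \<forall>i<n. s i \<in> carrier R \<and> v i = ?X +> s i" by metis
    then obtain s where s: "\<And>i. i < n \<Longrightarrow> s i \<in> carrier R \<and> v i = ?X +> s i" by blast
    have "v = cs (\<lambda>i. if i < n then s i else \<zero>)"
      using s v by (auto simp: fun_eq_iff cs_def X0 power_mod_def X.quot_mod_simps)
    moreover have "(\<lambda>i. if i < n then s i else \<zero>) \<in> V0" using s by (auto simp: V0_def)
    ultimately show "v \<in> cs ` V0" by blast
  next
    fix v assume "v \<in> cs ` V0"
    then show "v \<in> carrier ?L" by (auto simp: power_mod_def X.quot_mod_simps cs_def V0_def X0)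
  qed
  have La: "cs r \<oplus>\<^bsub>?L\<^esub> cs s = cs (r \<oplus>\<^bsub>?V\<^esub> s)" and V0a: "r \<oplus>\<^bsub>?V\<^esub> s \<in> V0" if "r \<in> V0" "s \<in> V0" for r s
    using that by (auto simp: power_mod_def X.quot_mod_simps cs_def V0_def X0 fun_eq_iff)
  have Ls: "a \<odot>\<^bsub>?L\<^esub> cs s = cs (a \<odot>\<^bsub>?V\<^esub> s)" and V0s: "a \<odot>\<^bsub>?V\<^esub> s \<in> V0" if "a \<in> carrier R" "s \<in> V0" for a s
    using that by (auto simp: power_mod_def X.quot_mod_simps cs_def V0_def X0 fun_eq_iff)
  \<comment> \<open>From left to right this makes f independent of the lift; from right to left it
    is the injectivity of f.\<close>
  have cs_\<pi>: "cs r = cs s \<longleftrightarrow> \<pi> r = \<pi> s" if r: "r \<in> V0" and s: "s \<in> V0" for r s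
  proof
    assume "cs r = cs s"
    then have X: "r i \<ominus> s i \<in> ?X" if "i < n" for i
      using rcos_eq_iff[OF Idl_x, of "r i" "s i"] r s that by (auto simp: cs_def V0_def fun_eq_iff)
    define w where "w = (\<lambda>i. r i \<ominus> s i)"
    have "w \<in> W" using X r s zc X.Icarr
      by (auto simp: W_def Vc w_def V0_def less_Suc_eq minus_eq intro!: bexI[of _ \<zero>])
    moreover have "r = w \<oplus>\<^bsub>?V\<^esub> s"
      using r s by (auto simp: fun_eq_iff Va w_def V0_def minus_eq a_assoc l_neg less_Suc_eq)
    ultimately show "\<pi> r = \<pi> s" using \<pi>_eq V0V r s by blast
  next
    assume "\<pi> r = \<pi> s"
    then obtain w where w: "w \<in> W" "r = w \<oplus>\<^bsub>?V\<^esub> s" using \<pi>_eq V0V r s by blast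
    then obtain b where b: "b \<in> carrier R" "w n = b \<otimes> y" "\<And>i. i < n \<Longrightarrow> w i \<oplus> b \<otimes> z i \<in> ?X"
      by (auto simp: W_def)
    have wc: "w i \<in> carrier R" if "i < Suc n" for i using w(1) that by (auto simp: W_def Vc)
    have "r n = w n \<oplus> s n" using w(2) by (simp add: Va)
    \<comment> \<open>Both last coordinates are 0, so b annihilates y and is a multiple of x. Hence
      the corrections b z_i vanish modulo x, and injectivity rests on (0:y) = (x).\<close>
    then have "b \<otimes> y = \<zero>" using V0V(2)[OF r] V0V(2)[OF s] b(1,2) by simp
    then obtain c where c: "c \<in> carrier R" "b = c \<otimes> x" using ann_y b(1) by blast
    have "r i \<ominus> s i \<in> ?X" if i: "i < n" for i
    proof -
      have "b \<otimes> z i = (c \<otimes> z i) \<otimes> x" using c zc[OF i] by (simp add: m_ac)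
      then have "b \<otimes> z i \<in> ?X" unfolding Xmem using c(1) zc[OF i] by blast
      then have "(w i \<oplus> b \<otimes> z i) \<oplus> \<ominus> (b \<otimes> z i) \<in> ?X" using b(3)[OF i] by simp
      then have "w i \<in> ?X" using wc[of i] i b(1) zc[OF i] by (simp add: a_assoc r_neg)
      moreover have "r i = w i \<oplus> s i" using w(2) i by (simp add: Va)
      moreover have "s i \<in> carrier R" using s i by (simp add: V0_def)
      ultimately show ?thesis using wc[of i] i by (simp add: minus_eq a_assoc r_neg)
    qed
    then have "?X +> r i = ?X +> s i" for i
      using rcos_eq_iff[OF Idl_x, of "r i" "s i"] r s by (cases "i < n") (simp_all add: V0_def)
    then show "cs r = cs s" by (simp add: cs_def)
  qed
  define f where "f v = \<pi> (SOME r. r \<in> V0 \<and> v = cs r)" for v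
  have f: "f (cs r) = \<pi> r" if "r \<in> V0" for r
  proof -
    have "(SOME s. s \<in> V0 \<and> cs r = cs s) \<in> V0 \<and> cs r = cs (SOME s. s \<in> V0 \<and> cs r = cs s)"
      by (rule someI[of "\<lambda>s. s \<in> V0 \<and> cs r = cs s" r]) (use that in simp)
    then show ?thesis using cs_\<pi> that unfolding f_def by metis
  qed
  define g where "g u = ?Y +> (SOME v. v \<in> carrier ?V \<and> u = \<pi> v) n" for u
  have g: "g (\<pi> v) = ?Y +> v n" if v: "v \<in> carrier ?V" for v
  proof -
    define s where "s = (SOME s. s \<in> carrier ?V \<and> \<pi> v = \<pi> s)"
    have s: "s \<in> carrier ?V \<and> \<pi> v = \<pi> s"
      unfolding s_def by (rule someI[of _ v]) (use v in simp)
    then obtain w where w: "w \<in> W" "s = w \<oplus>\<^bsub>?V\<^esub> v" using \<pi>_eq v by metis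
    then have "s n = w n \<oplus> v n" "w n \<in> ?Y" "w n \<in> carrier R" "v n \<in> carrier R"
      using v by (auto simp: Va W_def Vc Ymem)
    then have "?Y +> s n = ?Y +> v n"
      using rcos_eq_iff[OF Idl_y, of "s n" "v n"] by (simp add: minus_eq a_assoc r_neg)
    then show ?thesis by (simp add: g_def s_def)
  qed
  have vn: "v n \<in> carrier R" if "v \<in> carrier ?V" for v using that by (simp add: Vc)
  have "f \<in> mod_hom R ?L M"
    unfolding mod_hom_def L
    using V0V by (auto simp: f La Ls V0a V0s q(3,4) intro!: \<pi>_carr)
  moreover have "inj_on f (carrier ?L)"
    unfolding L by (rule inj_onI) (auto simp: f cs_\<pi>)
  moreover have "g \<in> mod_hom R M (quot_mod R ?Y)"
  proof -
    have "g (\<pi> u \<oplus>\<^bsub>M\<^esub> \<pi> v) = g (\<pi> u) \<oplus>\<^bsub>quot_mod R ?Y\<^esub> g (\<pi> v)"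
      if u: "u \<in> carrier ?V" and v: "v \<in> carrier ?V" for u v
      unfolding q(3)[OF u v] g[OF u] g[OF v] g[OF V.M.a_closed[OF u v]] Y.quot_mod_simps(3)[OF vn[OF u] vn[OF v]]
      by (simp add: Va)
    moreover have "g (a \<odot>\<^bsub>M\<^esub> \<pi> v) = a \<odot>\<^bsub>quot_mod R ?Y\<^esub> g (\<pi> v)"
      if a: "a \<in> carrier R" and v: "v \<in> carrier ?V" for a v
      unfolding q(4)[OF a v] g[OF v] g[OF V.smult_closed[OF a v]] Y.quot_mod_simps(4)[OF a vn[OF v]]
      by (simp add: Vs)
    ultimately show ?thesis
      unfolding mod_hom_def q(1) Y.quot_mod_simps(1) using vn by (auto simp: g)
  qed
  moreover have "g ` carrier M = carrier (quot_mod R ?Y)"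
  proof (intro equalityI subsetI)
    fix C assume "C \<in> carrier (quot_mod R ?Y)"
    then obtain c where c: "c \<in> carrier R" "C = ?Y +> c" by (auto simp: Y.quot_mod_simps)
    define v where "v = (\<lambda>k. if k = n then c else \<zero>)"
    have "v \<in> carrier ?V" "v n = c" using c by (auto simp: v_def Vc)
    then show "C \<in> g ` carrier M" using c g \<pi>_carr by (metis image_eqI)
  next
    fix C assume "C \<in> g ` carrier M"
    then show "C \<in> carrier (quot_mod R ?Y)"
      unfolding q(1) using vn by (auto simp: g Y.quot_mod_simps)
  qed
  moreover have "f ` carrier ?L = {u \<in> carrier M. g u = \<zero>\<^bsub>quot_mod R ?Y\<^esub>}"
  proof (intro equalityI subsetI)
    fix u assume "u \<in> f ` carrier ?L"
    then obtain r where r: "r \<in> V0" "u = \<pi> r" unfolding L using f by auto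
    have "?Y +> \<zero> = ?Y" using Y.a_subset by simp
    then show "u \<in> {u \<in> carrier M. g u = \<zero>\<^bsub>quot_mod R ?Y\<^esub>}"
      using r V0V[OF r(1)] \<pi>_carr by (simp add: g Y.quot_mod_simps(2))
  next
    fix u assume "u \<in> {u \<in> carrier M. g u = \<zero>\<^bsub>quot_mod R ?Y\<^esub>}"
    then have u: "u \<in> carrier M" "g u = ?Y" by (auto simp: Y.quot_mod_simps(2))
    then obtain v where v: "v \<in> carrier ?V" "u = \<pi> v" using \<pi>_surj by blast
    with u g have "?Y +> v n = ?Y" by metis
    with v have "v n \<in> ?Y" using rcos_eq_ideal_iff[OF Idl_y vn[OF v(1)]] by blast
    then obtain b where b: "b \<in> carrier R" "v n = b \<otimes> y" unfolding Ymem by blast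
    \<comment> \<open>Subtracting b times the relation y g_n - sum z_i g_i, which is the
      \<open>w\<close> below, clears the last coordinate of v without changing its class.\<close>
    define r where "r = (\<lambda>i. if i < n then v i \<oplus> b \<otimes> z i else \<zero>)"
    define w where "w = (\<lambda>i. if i < n then \<ominus> (b \<otimes> z i) else if i = n then b \<otimes> y else \<zero>)"
    have r: "r \<in> V0" using v(1) b(1) zc by (auto simp: V0_def r_def Vc)
    have "w \<in> W" using b zc
      by (auto simp: W_def Vc w_def l_neg intro!: bexI[of _ b])
    moreover have "v = w \<oplus>\<^bsub>?V\<^esub> r"
      using v(1) b zc by (auto simp: fun_eq_iff Va w_def r_def Vc a_lcomm l_neg r_neg r_neg1 r_neg2 a_comm less_Suc_eq)
    ultimately have "\<pi> v = \<pi> r" using \<pi>_eq v(1) V0V(1)[OF r] by blast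
    then have "u = f (cs r)" using f[OF r] v(2) by simp
    then show "u \<in> f ` carrier ?L" unfolding L using r by blast
  qed
  ultimately show ?thesis using M indec by blast
qed

section \<open>Choice of the generators\<close>

lemma ideal_mod_simps [simp]:
  "carrier (ideal_mod A I) = I" "\<zero>\<^bsub>ideal_mod A I\<^esub> = \<zero>\<^bsub>A\<^esub>"
  "u \<oplus>\<^bsub>ideal_mod A I\<^esub> v = u \<oplus>\<^bsub>A\<^esub> v" "r \<odot>\<^bsub>ideal_mod A I\<^esub> v = r \<otimes>\<^bsub>A\<^esub> v"
  by (simp_all add: ideal_mod_def ring_mod_def)

text \<open>Generation is phrased with submodules of \<open>ideal_mod\<close>, while preimages under
  the quotient map are taken of ideals; this is the passage between them.\<close>

lemma (in cring) submodule_ideal_mod_imp_ideal: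
  assumes H: "submodule H R (ideal_mod R I)" and I: "ideal I R"
  shows "ideal H R" "H \<subseteq> I"
proof -
  interpret I: ideal I R by (rule I)
  interpret H: submodule H R "ideal_mod R I" by (rule H)
  show sub: "H \<subseteq> I" using H.subset by simp
  then have HR: "H \<subseteq> carrier R" using I.a_subset by blast
  have l: "r \<otimes> u \<in> H" if "r \<in> carrier R" "u \<in> H" for r u
    using H.smult_closed[OF that] by simp
  show "ideal H R"
  proof (rule idealI)
    show "subgroup H (add_monoid R)"
    proof
      show "H \<subseteq> carrier (add_monoid R)" using HR by simp
      show "\<one>\<^bsub>add_monoid R\<^esub> \<in> H" using H.one_closed by simp
      show "u \<otimes>\<^bsub>add_monoid R\<^esub> v \<in> H" if "u \<in> H" "v \<in> H" for u v
        using H.m_closed[OF that] by simp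
      show "inv\<^bsub>add_monoid R\<^esub> u \<in> H" if u: "u \<in> H" for u
      proof -
        have "(\<ominus> \<one>) \<otimes> u = \<ominus> u" using u HR by (simp add: l_minus subsetD)
        then show ?thesis using l[of "\<ominus> \<one>" u] u by (simp add: a_inv_def)
      qed
    qed
    show "u \<otimes> r \<in> H" if "u \<in> H" "r \<in> carrier R" for u r
      using l[OF that(2,1)] that HR by (simp add: m_comm subsetD)
  qed (use l ring_axioms in auto)
qed

text \<open>Zorn's lemma for the ideals that contain a but not 1. Chains have upper bounds because
  in a Noetherian ring the union of a nonempty chain of ideals belongs to the chain.\<close>

lemma (in noetherian_ring) nonunit_in_maximal_ideal:
  assumes cring: "cring R" and a: "a \<in> carrier R" "a \<notin> Units R"
  shows "\<exists>M. maximalideal M R \<and> a \<in> M"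
proof -
  interpret cring R by (rule cring)
  define A where "A = {I. ideal I R \<and> a \<in> I \<and> \<one> \<notin> I}"
  have "Idl {a} \<in> A"
  proof -
    have "\<one> \<notin> Idl {a}"
    proof
      assume "\<one> \<in> Idl {a}"
      then obtain c where "c \<in> carrier R" "\<one> = c \<otimes> a" using mem_genideal_sing[OF a(1)] by blast
      then show False using a m_comm[of c a] by (auto simp: Units_def)
    qed
    then show ?thesis using genideal_ideal[of "{a}"] genideal_self[of "{a}"] a by (auto simp: A_def)
  qed
  then have "A \<noteq> {}" by blast
  moreover have "\<Union>C \<in> A" if "C \<noteq> {}" "subset.chain A C" for C
  proof -
    have "subset.chain {I. ideal I R} C" using that(2) by (auto simp: pred_on.chain_def A_def)
    then have "\<Union>C \<in> C" by (rule ideal_chain_is_trivial[OF that(1)])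
    then show ?thesis using that(2) by (auto simp: pred_on.chain_def)
  qed
  ultimately obtain M where M: "M \<in> A" "\<And>I. I \<in> A \<Longrightarrow> M \<subseteq> I \<Longrightarrow> I = M"
    using subset_Zorn_nonempty[of A] by blast
  then have id: "ideal M R" "a \<in> M" "\<one> \<notin> M" by (auto simp: A_def)
  have "maximalideal M R"
  proof (rule maximalidealI[OF id(1)])
    show "carrier R \<noteq> M" using id by auto
    fix J assume J: "ideal J R" "M \<subseteq> J" "J \<subseteq> carrier R"
    show "J = M \<or> J = carrier R"
    proof (cases "\<one> \<in> J")
      case True then show ?thesis using ideal.one_imp_carrier[OF J(1)] by blast
    next
      case False then show ?thesis using M(2)[of J] J id by (auto simp: A_def)
    qed
  qed
  then show ?thesis using id by blast
qed

lemma local_cringI: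
  assumes "cring R" "noetherian_ring R" "local_ring R" "maximalideal m R"
  shows "local_cring R m"
proof -
  interpret cring R by fact
  interpret noetherian_ring R by fact
  interpret m: maximalideal m R by fact
  show ?thesis
  proof (unfold_locales)
    fix a assume a: "a \<in> carrier R"
    show "a \<in> Units R \<longleftrightarrow> a \<notin> m"
    proof
      assume u: "a \<in> Units R"
      show "a \<notin> m"
      proof
        assume "a \<in> m"
        then have "inv\<^bsub>R\<^esub> a \<otimes>\<^bsub>R\<^esub> a \<in> m" using u by (intro m.I_l_closed) auto
        then have "\<one>\<^bsub>R\<^esub> \<in> m" using u by simp
        then show False using m.one_imp_carrier m.I_notcarr by simp
      qed
    next
      assume "a \<notin> m"
      then show "a \<in> Units R"
        using nonunit_in_maximal_ideal[OF assms(1) a] assms(3,4) unfolding local_ring_def by blast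
    qed
  qed
qed

lemma exact_zdI:
  assumes "local_cring R m" "exact_zerodivisors R m x y"
  shows "exact_zd R m x y"
proof -
  interpret local_cring R m by fact
  have x: "x \<in> m" "y \<in> m" and ann: "annihilator R x = Idl\<^bsub>R\<^esub> {y}" "annihilator R y = Idl\<^bsub>R\<^esub> {x}"
    using assms(2) unfolding exact_zerodivisors_def by auto
  have "r \<otimes>\<^bsub>R\<^esub> x = \<zero>\<^bsub>R\<^esub> \<longleftrightarrow> r \<in> Idl\<^bsub>R\<^esub> {y}" "r \<otimes>\<^bsub>R\<^esub> y = \<zero>\<^bsub>R\<^esub> \<longleftrightarrow> r \<in> Idl\<^bsub>R\<^esub> {x}"
    if "r \<in> carrier R" for r
    using that unfolding ann[symmetric] annihilator_def by auto
  then show ?thesis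
    using x mem_genideal_sing by unfold_locales auto
qed

text \<open>Take a generating set T of least size for an ideal that needs at least n generators, and
  lift n of its members. A relation modulo (x,y) with a unit coefficient would make one of these
  members redundant, so T could be shortened.\<close>

lemma (in exact_zd) indep_mod_xy_exists:
  assumes noeth: "noetherian_ring R" and n: "enat n \<le> s_inv R x y"
  shows "\<exists>z. indep_mod_xy n z"
proof (cases "n = 0")
  case True
  then show ?thesis by (auto simp: indep_mod_xy_def)
next
  case False
  let ?J = "Idl {x, y}"
  let ?S = "R Quot ?J"
  let ?h = "(+>) ?J"
  let ?K = "\<lambda>I. Idl\<^bsub>?S\<^esub> (?h ` I)"
  interpret J: ideal ?J R by (rule Idl_xy)
  interpret h: ring_hom_cring R ?S ?h by (rule J.rcos_ring_hom_cring[OF is_cring])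
  \<comment> \<open>The supremum may be infinite, so only an ideal needing at least n generators can
    be expected. If all numbers were below n, their supremum would be at most n - 1, which is
    smaller than n because n is positive.\<close>
  have "\<exists>I. ideal I R \<and> n \<le> mu_gens ?S (ideal_mod ?S (?K I))"
  proof (rule ccontr)
    assume *: "\<not> ?thesis"
    have "s_inv R x y \<le> enat (n - 1)"
      unfolding s_inv_def Let_def
    proof (rule Sup_least)
      fix e assume "e \<in> {enat (mu_gens ?S (ideal_mod ?S (?K I))) |I. ideal I R}"
      then obtain I where "ideal I R" "e = enat (mu_gens ?S (ideal_mod ?S (?K I)))" by blast
      then show "e \<le> enat (n - 1)" using * by (force simp: not_le)
    qed
    then show False using n False by (meson diff_less enat_ord_simps(1) leD le_less_trans less_one neq0_conv order_trans)
  qed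
  then obtain I where I: "ideal I R" and nI: "n \<le> mu_gens ?S (ideal_mod ?S (?K I))" by blast
  have hI: "?h ` I \<subseteq> carrier ?S" using ideal.Icarr[OF I] by auto
  have K: "ideal (?K I) ?S" using h.S.genideal_ideal[OF hI] .
  let ?N = "ideal_mod ?S (?K I)"
  have zero_iff: "?h r = \<zero>\<^bsub>?S\<^esub> \<longleftrightarrow> r \<in> ?J" if "r \<in> carrier R" for r
    using rcos_eq_ideal_iff[OF Idl_xy that] by (simp add: zero_Quot)
  have preim: "ideal {r \<in> carrier R. ?h r \<in> H} R" if "ideal H ?S" for H
    using ring_hom_ring.ideal_vimage[OF J.rcos_ring_hom_ring that] by simp
  obtain A where A: "A \<subseteq> carrier R" "finite A" "I = Idl A"
    using noetherian_ring.finetely_gen[OF noeth I] by blast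
  \<comment> \<open>A finite generating set must be exhibited before the \<open>LEAST\<close> in
    \<open>mu_gens\<close> is known to be attained; Noetherianity provides one.\<close>
  have "generates ?S ?N (?h ` A)"
    unfolding generates_def
  proof (intro conjI allI impI)
    show "?h ` A \<subseteq> carrier ?N"
      using A genideal_self[OF A(1)] h.S.genideal_self[OF hI] by auto
    fix H assume H: "submodule H ?S ?N \<and> ?h ` A \<subseteq> H"
    then have idH: "ideal H ?S" using h.S.submodule_ideal_mod_imp_ideal K by blast
    have "I \<subseteq> {r \<in> carrier R. ?h r \<in> H}"
      unfolding A(3) using A(1) H by (intro genideal_minimal preim[OF idH]) auto
    then have "?h ` I \<subseteq> H" by blast
    then show "carrier ?N \<subseteq> H" using h.S.genideal_minimal[OF idH] by simp
  qed
  then have "\<exists>T. finite T \<and> card T = mu_gens ?S ?N \<and> generates ?S ?N T"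
    unfolding mu_gens_def using A(2)
    by (intro LeastI_ex[of "\<lambda>k. \<exists>T. finite T \<and> card T = k \<and> generates ?S ?N T"]) blast
  then obtain T where T: "finite T" "card T = mu_gens ?S ?N" "generates ?S ?N T" by blast
  have minimal: "\<not> generates ?S ?N (T - {t})" if "t \<in> T" for t
  proof
    assume "generates ?S ?N (T - {t})"
    then have "mu_gens ?S ?N \<le> card (T - {t})"
      unfolding mu_gens_def using T(1) by (intro Least_le) blast
    moreover have "card (T - {t}) < card T" using T(1) that by (rule card_Diff1_less)
    ultimately show False using T(2) by simp
  qed
  have TK: "T \<subseteq> ?K I" using T(3) by (simp add: generates_def)
  \<comment> \<open>T may have more than n elements; only the first n in this enumeration are
    lifted.\<close>
  obtain e where e: "bij_betw e {0..<card T} T" using ex_bij_betw_nat_finite[OF T(1)] by blast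
  have eT: "e i \<in> T" if "i < n" for i using e that nI T(2) by (auto simp: bij_betw_def)
  have e_inj: "e i \<noteq> e k" if "i < n" "k < n" "i \<noteq> k" for i k
    using e that nI T(2) by (auto simp: bij_betw_def dest: inj_onD)
  have "\<exists>r\<in>carrier R. e i = ?h r" if "i < n" for i
  proof -
    have "e i \<in> ?h ` carrier R"
      using eT[OF that] TK ideal.Icarr[OF K] unfolding carrier_Quot[symmetric] by blast
    then show ?thesis by blast
  qed
  then obtain z where z: "\<And>i. i < n \<Longrightarrow> z i \<in> carrier R" "\<And>i. i < n \<Longrightarrow> e i = ?h (z i)" by metis
  have "a k \<in> m" if a: "\<forall>j<n. a j \<in> carrier R" and sum: "(\<Oplus>j\<in>{..<n}. a j \<otimes> z j) \<in> ?J" and k: "k < n" for a k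
  proof (rule ccontr)
    assume "a k \<notin> m"
    then have u: "a k \<in> Units R" using Units_iff a k by blast
    have "generates ?S ?N (T - {e k})"
      unfolding generates_def
    proof (intro conjI allI impI)
      show "T - {e k} \<subseteq> carrier ?N" using TK by auto
      fix H assume H: "submodule H ?S ?N \<and> T - {e k} \<subseteq> H"
      then have idH: "ideal H ?S" using h.S.submodule_ideal_mod_imp_ideal K by blast
      \<comment> \<open>The relation is known only modulo (x,y). The preimage of H in R contains
        (x,y), so the relation can be solved for z_k inside it.\<close>
      define P where "P = {r \<in> carrier R. ?h r \<in> H}"
      interpret P: ideal P R unfolding P_def by (rule preim[OF idH])
      interpret RM: module R "ring_mod R" by (rule module_ring_mod)
      have zP: "z j \<in> P" if "j < n" "j \<noteq> k" for j
      proof -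
        have "e j \<in> H" using H eT[OF that(1)] e_inj[OF that(1) k that(2)] by blast
        then show ?thesis unfolding P_def z(2)[OF that(1)] using z(1)[OF that(1)] by blast
      qed
      have JP: "r \<in> P" if "r \<in> ?J" for r
      proof -
        have r: "r \<in> carrier R" using that by (rule J.Icarr)
        have "\<zero>\<^bsub>?S\<^esub> \<in> H" using additive_subgroup.zero_closed[OF ideal.axioms(1)[OF idH]] .
        then have "?h r \<in> H" using zero_iff[OF r] that by metis
        with r show ?thesis unfolding P_def by blast
      qed
      let ?s = "\<Oplus>j\<in>{..<n} - {k}. a j \<otimes> z j"
      have s: "?s \<in> P"
        using RM.submodule_finsum_closed[OF submodule_ring_mod_ideal[OF module_ring_mod P.ideal_axioms], of "{..<n} - {k}" "\<lambda>j. a j \<otimes> z j"]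
          a zP P.I_l_closed by (simp add: finsum_ring_mod)
      have "(\<Oplus>j\<in>{..<n}. a j \<otimes> z j) = a k \<otimes> z k \<oplus> ?s"
      proof -
        have "{..<n} = insert k ({..<n} - {k})" using k by auto
        moreover have "(\<Oplus>j\<in>insert k ({..<n} - {k}). a j \<otimes> z j) = a k \<otimes> z k \<oplus> ?s"
          using a z k by (intro finsum_insert) auto
        ultimately show ?thesis by simp
      qed
      then have "(a k \<otimes> z k \<oplus> ?s) \<oplus> \<ominus> ?s \<in> P" using JP[OF sum] s by simp
      moreover have "?s \<in> carrier R" using s by auto
      ultimately have "a k \<otimes> z k \<in> P" using a z(1)[OF k] k by (simp add: a_assoc r_neg)
      then have "inv (a k) \<otimes> (a k \<otimes> z k) \<in> P" using Units_inv_closed[OF u] by (rule P.I_l_closed)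
      also have "inv (a k) \<otimes> (a k \<otimes> z k) = z k"
        using u z(1)[OF k] by (simp add: m_assoc[symmetric] Units_closed)
      finally have "z k \<in> P" .
      then have "e k \<in> H" unfolding z(2)[OF k] P_def by blast
      then have "T \<subseteq> H" using H by blast
      then show "carrier ?N \<subseteq> H" using T(3) H unfolding generates_def by blast
    qed
    then show False using minimal[OF eT[OF k]] by blast
  qed
  then show ?thesis using z(1) unfolding indep_mod_xy_def by blast
qed

theorem theorem3p6:
  fixes R :: "'a ring" and m :: "'a set" and x y :: 'a
  assumes "cring R" and "noetherian_ring R" and "local_ring R"
    and "maximalideal m R"
    and "exact_zerodivisors R m x y"
    and "G_regular (R Quot Idl\<^bsub>R\<^esub> {x})"
  shows "\<forall>n::nat. enat n \<le> s_inv R x y \<longrightarrow>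
    (\<exists>(M :: ('a, (nat \<Rightarrow> 'a) set) module) f g.
        module R M \<and>
        f \<in> mod_hom R (power_mod (quot_mod R (Idl\<^bsub>R\<^esub> {x})) n) M \<and>
        inj_on f (carrier (power_mod (quot_mod R (Idl\<^bsub>R\<^esub> {x})) n)) \<and>
        g \<in> mod_hom R M (quot_mod R (Idl\<^bsub>R\<^esub> {y})) \<and>
        g ` carrier M = carrier (quot_mod R (Idl\<^bsub>R\<^esub> {y})) \<and>
        f ` carrier (power_mod (quot_mod R (Idl\<^bsub>R\<^esub> {x})) n)
          = {u \<in> carrier M. g u = \<zero>\<^bsub>quot_mod R (Idl\<^bsub>R\<^esub> {y})\<^esub>} \<and>
        indecomposable R M)"
proof (intro allI impI)
  fix n :: nat
  assume n: "enat n \<le> s_inv R x y"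
  interpret exact_zd R m x y
    by (rule exact_zdI[OF local_cringI[OF assms(1-4)] assms(5)])
  obtain z where "indep_mod_xy n z" using indep_mod_xy_exists[OF assms(2) n] by blast
  from extension_exists[OF assms(6) this]
  show "\<exists>(M :: ('a, (nat \<Rightarrow> 'a) set) module) f g.
        module R M \<and>
        f \<in> mod_hom R (power_mod (quot_mod R (Idl\<^bsub>R\<^esub> {x})) n) M \<and>
        inj_on f (carrier (power_mod (quot_mod R (Idl\<^bsub>R\<^esub> {x})) n)) \<and>
        g \<in> mod_hom R M (quot_mod R (Idl\<^bsub>R\<^esub> {y})) \<and>
        g ` carrier M = carrier (quot_mod R (Idl\<^bsub>R\<^esub> {y})) \<and>
        f ` carrier (power_mod (quot_mod R (Idl\<^bsub>R\<^esub> {x})) n)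
          = {u \<in> carrier M. g u = \<zero>\<^bsub>quot_mod R (Idl\<^bsub>R\<^esub> {y})\<^esub>} \<and>
        indecomposable R M" .
qed

end
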